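(* Let $\mathcal{G}=(V,E)$ be a (general, not necessarily bipartite) graph, and for each edge $e\in E$ let $D_e$ be a distribution over nonnegative reals, the distributions being independent across edges. For each edge $e$, a reward $r_e\sim D_e$ and a single sample $s_e\sim D_e$ are drawn, all independently. Consider the following online algorithm. First, compute the greedy matching $M_S$ with respect to the sample weights $s_e$ (process edges in non-increasing order of $s_e$, ties broken uniformly at random, and add an edge whenever the result is still a matching). For each edge $e=\{u,v\}\in M_S$ set prices $p_u=p_v=s_e$; for each vertex $u$ unmatched in $M_S$ set $p_u=0$. Start with $M=\emptyset$. Then edges arrive one by one in an arbitrary (adversarial) order; when $e=\{u,v\}$ arrives, its reward $r_e$ is revealed, and $e$ is added irrevocably to $M$ if and only if $r_e\ge \max\{p_u,p_v\}$ and neither $u$ nor $v$ is already matched in $M$. Then, for any arrival order, $16\cdot \mathbb{E}[w(M)]\ge \mathbb{E}[\mathsf{OPT}]$, where $w(M)=\sum_{e\in M} r_e$ and $\mathsf{OPT}$ is the weight of a maximum-weight matching in $\mathcal{G}$ with respect to the rewards $(r_e)_{e\in E}$.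
   Context: This is the single-sample prophet inequality setting for maximum-weight matching with edge arrivals: the algorithm does not know the distributions, only one independent sample per edge, and must decide irrevocably upon each edge's arrival.
   Formalization: With atoms the claim fails for the literal test r_e ≥ max{p_u,p_v}; so it is proved verbatim for atomless D_e, and for arbitrary D_e with a reward equal to a price compared by the uniformly random ordering of all samples and rewards that also breaks the greedy ties. *)

theory Defs
  imports "HOL-Probability.Probability" "HOL-Combinatorics.Multiset_Permutations"
begin

text \<open>A graph is a finite set of two-element edges; a matching is a pairwise disjoint set of edges.\<close>

definition graph :: "'v set \<Rightarrow> 'v set set \<Rightarrow> bool" where
  "graph V E \<longleftrightarrow> finite V \<and> (\<forall>e\<in>E. e \<subseteq> V \<and> card e = 2)"

definition matching :: "'v set set \<Rightarrow> 'v set set \<Rightarrow> bool" where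
  "matching E N \<longleftrightarrow> N \<subseteq> E \<and> disjoint N"

definition weight :: "('v set \<Rightarrow> real) \<Rightarrow> 'v set set \<Rightarrow> real" where
  "weight r N = (\<Sum>e\<in>N. r e)"

definition opt :: "'v set set \<Rightarrow> ('v set \<Rightarrow> real) \<Rightarrow> real" where
  "opt E r = Max (weight r ` {N. matching E N})"

text \<open>
  Ties are resolved by a uniformly random ordering \<open>\<tau>\<close> of all samples and rewards: of two equal
  values, the one occurring earlier in \<open>\<tau>\<close> counts as the larger one.
\<close>

datatype draw = Sample | Reward

definition tie_orders :: "'v set set \<Rightarrow> ('v set \<times> draw) list set" where
  "tie_orders E = permutations_of_set (E \<times> {Sample, Reward})"

definition precedes :: "'a list \<Rightarrow> 'a \<Rightarrow> 'a \<Rightarrow> bool" where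
  "precedes \<tau> a b \<longleftrightarrow> (\<exists>i j. i < j \<and> j < length \<tau> \<and> \<tau> ! i = a \<and> \<tau> ! j = b)"

text \<open>
  As \<open>sort_key\<close> is stable, edges with equal sample weights are processed in the order in which their
  samples occur in \<open>\<tau>\<close>, which is uniformly random.
\<close>

definition greedy_order ::
  "('v set \<times> draw) list \<Rightarrow> ('v set \<Rightarrow> real) \<Rightarrow> 'v set list" where
  "greedy_order \<tau> s = sort_key (\<lambda>e. - s e) (map fst (filter (\<lambda>t. snd t = Sample) \<tau>))"

definition sample_matching ::
  "('v set \<times> draw) list \<Rightarrow> ('v set \<Rightarrow> real) \<Rightarrow> 'v set set" where
  "sample_matching \<tau> s =
     fold (\<lambda>e N. if disjoint (insert e N) then insert e N else N) (greedy_order \<tau> s) {}"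

definition price :: "('v set \<Rightarrow> real) \<Rightarrow> 'v set set \<Rightarrow> 'v \<Rightarrow> real" where
  "price s N u = (if u \<in> \<Union>N then s (THE e. e \<in> N \<and> u \<in> e) else 0)"

definition online_matching :: "('v set \<Rightarrow> bool) \<Rightarrow> 'v set list \<Rightarrow> 'v set set" where
  "online_matching accept \<sigma> =
     fold (\<lambda>e M. if accept e \<and> e \<inter> \<Union>M = {} then insert e M else M) \<sigma> {}"

definition alg ::
  "'v set list \<Rightarrow> ('v set \<times> draw) list \<Rightarrow> ('v set \<Rightarrow> real) \<Rightarrow> ('v set \<Rightarrow> real) \<Rightarrow> 'v set set" where
  "alg \<sigma> \<tau> s r =
     online_matching (\<lambda>e. r e \<ge> Max (price s (sample_matching \<tau> s) ` e)) \<sigma>"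

text \<open>
  The same algorithm, except that the tie-breaking ordering also decides the comparison of a reward
  with an equal price. If the distributions have no atoms, the two algorithms agree almost surely.
  With atoms the plain comparison admits no constant competitive ratio: on a path with two edges,
  let the first arriving reward be constantly \<open>0\<close> and let the second one be \<open>1 / \<epsilon>\<close> with
  probability \<open>\<epsilon>\<close> and \<open>0\<close> otherwise. Both prices of the first edge are \<open>0\<close> with probability
  \<open>1 - \<epsilon>\<close>; then the first edge is accepted. The algorithm earns \<open>\<epsilon>\<close> in expectation, the optimum \<open>1\<close>.
\<close>

definition clears ::
  "('v set \<times> draw) list \<Rightarrow> ('v set \<Rightarrow> real) \<Rightarrow> ('v set \<Rightarrow> real) \<Rightarrow> 'v set set \<Rightarrow> 'v set \<Rightarrow> 'v \<Rightarrow> bool"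
where
  "clears \<tau> s r N e u \<longleftrightarrow>
     r e > price s N u \<or>
     r e = price s N u \<and> (\<forall>f\<in>N. u \<in> f \<longrightarrow> precedes \<tau> (e, Reward) (f, Sample))"

definition alg_ties ::
  "'v set list \<Rightarrow> ('v set \<times> draw) list \<Rightarrow> ('v set \<Rightarrow> real) \<Rightarrow> ('v set \<Rightarrow> real) \<Rightarrow> 'v set set" where
  "alg_ties \<sigma> \<tau> s r =
     online_matching (\<lambda>e. \<forall>u\<in>e. clears \<tau> s r (sample_matching \<tau> s) e u) \<sigma>"

text \<open>
  Independent rewards, samples and tie-breaking. The uniform distribution on orderings is a
  \<open>uniform_count_measure\<close> rather than a \<open>pmf\<close> so that its space is finite; otherwise joint
  measurability would fail for uncountable vertex types.
\<close>

definition outcomes ::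
  "'v set set \<Rightarrow> ('v set \<Rightarrow> real measure) \<Rightarrow>
   (('v set \<times> draw) list \<times> ('v set \<Rightarrow> real) \<times> ('v set \<Rightarrow> real)) measure" where
  "outcomes E D = uniform_count_measure (tie_orders E) \<Otimes>\<^sub>M (PiM E D \<Otimes>\<^sub>M PiM E D)"

end

theory Submission
  imports Defs
begin

text \<open>
  Merge all samples and rewards into one list, sorted by decreasing value, and let a fair coin per
  edge decide which of its two values is the sample. Reading the list, the greedy sample matching
  \<open>N\<close> grows, and a reward clears its prices iff its edge is disjoint from \<open>N\<close> when it is read; let
  \<open>A\<close> be the set of these edges, \<open>H\<close> the greedy matching inside \<open>A\<close>, and \<open>m f\<close> the least reward
  in \<open>A\<close> of an edge meeting \<open>f \<in> H\<close>. In expectation over the coins, the potential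
  \<open>(\<Sum>f\<in>H. 2 ^ card (f \<inter> \<Union>N) * m f) - weight s N\<close> never decreases: if the next edge is disjoint
  from \<open>N\<close>, then as a sample it doubles the terms of the edges \<open>f\<close> it meets, at the cost of its
  value \<open>x\<close>; as a reward it lowers each of these \<open>m f\<close> to \<open>x \<ge> 0\<close>, or enters \<open>H\<close> with the term
  \<open>x\<close> if it meets none. An edge read for the second time involves no coin: it can only matter as a
  sample, and then it lies in \<open>A\<close> and doubles some term with \<open>m f \<ge> x\<close>. So the expected weight of
  \<open>N\<close> is at most the expectation of \<open>4 * (\<Sum>f\<in>H. m f)\<close>. The online
  matching is maximal in \<open>A\<close>, hence weighs at least half of \<open>\<Sum>f\<in>H. m f\<close>, and \<open>N\<close> weighs at least
  half of the optimum for the samples, which is distributed like the optimum for the rewards.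
\<close>

subsection \<open>The potential\<close>

primrec other :: "draw \<Rightarrow> draw" where
  "other Sample = Reward" | "other Reward = Sample"

definition flip :: "'v set set \<Rightarrow> 'v set \<times> draw \<Rightarrow> 'v set \<times> draw" where
  "flip c i = (fst i, if fst i \<in> c then other (snd i) else snd i)"

lemma other_other [simp]: "other (other d) = d"
  by (cases d) auto

lemma flip_flip [simp]: "flip c (flip c i) = i"
  by (simp add: flip_def)

lemma fst_flip [simp]: "fst (flip c i) = fst i"
  by (simp add: flip_def)

lemma inj_flip: "inj_on (flip c) A"
  by (metis flip_flip inj_onI)

lemma flip_in_iff: "flip c i \<in> E \<times> {Sample, Reward} \<longleftrightarrow> i \<in> E \<times> {Sample, Reward}"
  by (cases i; cases "snd i") (auto simp: flip_def)

lemma flip_image: "flip c ` (E \<times> {Sample, Reward}) = E \<times> {Sample, Reward}"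
  (is "_ = ?I")
proof
  show sub: "flip c ` ?I \<subseteq> ?I" using flip_in_iff by blast
  have "?I = flip c ` flip c ` ?I" by (simp add: image_image)
  also have "\<dots> \<subseteq> flip c ` ?I" using sub by (rule image_mono)
  finally show "?I \<subseteq> flip c ` ?I" .
qed

text \<open>In the functions below the argument is the part of the list read so far, latest item first.\<close>

fun greedy :: "('v set \<times> draw) list \<Rightarrow> 'v set set" where
  "greedy [] = {}"
| "greedy ((e, d) # ls) =
     (if d = Sample \<and> e \<inter> \<Union>(greedy ls) = {} then insert e (greedy ls) else greedy ls)"

fun accepted :: "('v set \<times> draw) list \<Rightarrow> 'v set set" where
  "accepted [] = {}"
| "accepted ((e, d) # ls) =
     (if d = Reward \<and> e \<inter> \<Union>(greedy ls) = {} then insert e (accepted ls) else accepted ls)"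

fun core :: "('v set \<times> draw) list \<Rightarrow> 'v set set" where
  "core [] = {}"
| "core ((e, d) # ls) =
     (if d = Reward \<and> e \<inter> \<Union>(greedy ls) = {} \<and> e \<inter> \<Union>(core ls) = {}
      then insert e (core ls) else core ls)"

fun last_val :: "('v set \<times> draw \<Rightarrow> real) \<Rightarrow> ('v set \<times> draw) list \<Rightarrow> 'v set \<Rightarrow> real" where
  "last_val y [] f = 0"
| "last_val y ((e, d) # ls) f =
     (if d = Reward \<and> e \<inter> \<Union>(greedy ls) = {} \<and> e \<inter> f \<noteq> {} then y (e, d) else last_val y ls f)"

definition potential :: "('v set \<times> draw \<Rightarrow> real) \<Rightarrow> ('v set \<times> draw) list \<Rightarrow> real" where
  "potential y ls = (\<Sum>f\<in>core ls. 2 ^ card (f \<inter> \<Union>(greedy ls)) * last_val y ls f) - (\<Sum>f\<in>greedy ls. y (f, Sample))"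

lemma greedy_mono: "greedy ls \<subseteq> greedy (i # ls)"
  by (cases i) auto

lemma greedy_subset: "f \<in> greedy ls \<Longrightarrow> (f, Sample) \<in> set ls"
  by (induction ls) (auto split: if_splits)

lemma accepted_subset: "f \<in> accepted ls \<Longrightarrow> (f, Reward) \<in> set ls"
  by (induction ls) (auto split: if_splits)

lemma core_subset: "core ls \<subseteq> accepted ls"
  by (induction ls) (auto split: if_splits)

lemma finite_greedy [simp]: "finite (greedy ls)"
  by (induction ls) auto

lemma finite_accepted [simp]: "finite (accepted ls)"
  by (induction ls) auto

lemma finite_core [simp]: "finite (core ls)"
  by (rule finite_subset[OF core_subset]) simp

lemma disjoint_greedy: "disjoint (greedy ls)"
proof (induction ls)
  case (Cons i ls)
  then show ?case by (cases i) (auto simp: disjoint_def)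
qed simp

lemma disjoint_core: "disjoint (core ls)"
proof (induction ls)
  case (Cons i ls)
  then show ?case by (cases i) (auto simp: disjoint_def)
qed simp

lemma greedy_meets: "(e, Sample) \<in> set ls \<Longrightarrow> e \<noteq> {} \<Longrightarrow> e \<inter> \<Union>(greedy ls) \<noteq> {}"
proof (induction ls)
  case (Cons i ls)
  show ?case
  proof (cases "i = (e, Sample)")
    case True
    then show ?thesis using Cons.prems by (cases "e \<inter> \<Union>(greedy ls) = {}") auto
  next
    case False
    then have "e \<inter> \<Union>(greedy ls) \<noteq> {}" using Cons by auto
    then show ?thesis using greedy_mono[of ls i] by blast
  qed
qed simp

lemma accepted_meets_core: "e \<in> accepted ls \<Longrightarrow> e \<noteq> {} \<Longrightarrow> e \<inter> \<Union>(core ls) \<noteq> {}"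
proof (induction ls)
  case (Cons i ls)
  show ?case
  proof (cases "e \<in> accepted ls")
    case True
    then have "e \<inter> \<Union>(core ls) \<noteq> {}" using Cons by auto
    moreover have "core ls \<subseteq> core (i # ls)" by (cases i) auto
    ultimately show ?thesis by blast
  next
    case False
    then have "i = (e, Reward)" "e \<inter> \<Union>(greedy ls) = {}"
      using Cons.prems by (cases i; auto split: if_splits)+
    then show ?thesis using Cons.prems by (cases "e \<inter> \<Union>(core ls) = {}") auto
  qed
qed simp

lemma open_reward_accepted:
  "(e, Reward) \<in> set ls \<Longrightarrow> e \<inter> \<Union>(greedy ls) = {} \<Longrightarrow> e \<in> accepted ls"
proof (induction ls)
  case (Cons i ls)
  have "e \<inter> \<Union>(greedy ls) = {}" using Cons.prems(2) greedy_mono[of ls i] by blast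
  then show ?case using Cons by (cases i) auto
qed simp

lemma last_val_in: "f \<in> core ls \<Longrightarrow> f \<noteq> {} \<Longrightarrow> last_val y ls f \<in> y ` set ls"
  by (induction ls) (auto split: if_splits)

lemma last_val_le:
  assumes "sorted_wrt (\<lambda>i j. y i \<le> y j) ls" "f \<in> core ls" "g \<in> accepted ls" "g \<inter> f \<noteq> {}"
  shows "last_val y ls f \<le> y (g, Reward)"
  using assms
proof (induction ls)
  case (Cons i ls)
  obtain e d where i: "i = (e, d)" by (cases i)
  show ?case
  proof (cases "d = Reward \<and> e \<inter> \<Union>(greedy ls) = {}")
    case False
    then show ?thesis using Cons i by (auto split: if_splits)
  next
    case True
    show ?thesis
    proof (cases "e \<inter> f = {}")
      case False
      have "y (e, Reward) \<le> y (g, Reward)"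
        using Cons.prems True i accepted_subset[of g ls] by auto
      then show ?thesis using False True i by simp
    next
      case e: True
      then have "f \<in> core ls" "g \<in> accepted ls"
        using Cons.prems True i by (auto split: if_splits)
      then show ?thesis using Cons e True i by auto
    qed
  qed
qed simp

lemma last_val_cong: "(\<And>i. i \<in> set ls \<Longrightarrow> y i = y' i) \<Longrightarrow> last_val y ls f = last_val y' ls f"
  by (induction ls) auto

lemma potential_cong:
  assumes "\<And>i. i \<in> set ls \<Longrightarrow> y i = y' i" shows "potential y ls = potential y' ls"
proof -
  have "last_val y ls = last_val y' ls" using last_val_cong assms by (metis ext)
  moreover have "(\<Sum>f\<in>greedy ls. y (f, Sample)) = (\<Sum>f\<in>greedy ls. y' (f, Sample))"
    using assms greedy_subset by (metis (no_types, lifting) sum.cong)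
  ultimately show ?thesis by (simp add: potential_def)
qed

lemma core_sum_insert_ge:
  fixes y :: "'v set \<times> draw \<Rightarrow> real"
  assumes fin: "\<And>f. f \<in> core ls \<Longrightarrow> finite f" and nonneg: "\<And>f. f \<in> core ls \<Longrightarrow> 0 \<le> m f"
    and e: "e \<inter> \<Union>(greedy ls) = {}"
  shows "(\<Sum>f\<in>core ls. 2 ^ card (f \<inter> \<Union>(greedy ls)) * m f)
           + (\<Sum>f\<in>{f \<in> core ls. e \<inter> f \<noteq> {}}. 2 ^ card (f \<inter> \<Union>(greedy ls)) * m f)
         \<le> (\<Sum>f\<in>core ls. 2 ^ card (f \<inter> \<Union>(insert e (greedy ls))) * (m f :: real))"
proof -
  have "2 ^ card (f \<inter> \<Union>(greedy ls)) * m f + (if e \<inter> f \<noteq> {} then 2 ^ card (f \<inter> \<Union>(greedy ls)) * m f else 0)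
        \<le> 2 ^ card (f \<inter> \<Union>(insert e (greedy ls))) * m f" if f: "f \<in> core ls" for f
  proof -
    have "f \<inter> \<Union>(insert e (greedy ls)) = (f \<inter> e) \<union> (f \<inter> \<Union>(greedy ls))" by auto
    moreover have "(f \<inter> e) \<inter> (f \<inter> \<Union>(greedy ls)) = {}" using e by auto
    ultimately have c: "card (f \<inter> \<Union>(insert e (greedy ls))) = card (f \<inter> e) + card (f \<inter> \<Union>(greedy ls))"
      using fin[OF f] by (metis card_Un_disjoint finite_Int)
    have "(2::real) ^ card (f \<inter> e) \<ge> (if e \<inter> f \<noteq> {} then 2 else 1)"
    proof (cases "e \<inter> f = {}")
      case False
      then have "1 \<le> card (f \<inter> e)" using fin[OF f] by (simp add: Suc_leI card_gt_0_iff inf_commute)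
      then show ?thesis using False power_increasing[of 1 "card (f \<inter> e)" "2::real"] by simp
    qed simp
    then have "(if e \<inter> f \<noteq> {} then 2 else 1) * (2 ^ card (f \<inter> \<Union>(greedy ls)) * m f)
        \<le> 2 ^ card (f \<inter> e) * (2 ^ card (f \<inter> \<Union>(greedy ls)) * m f)"
      using nonneg[OF f] by (intro mult_right_mono) auto
    then show ?thesis unfolding c power_add
      by (cases "e \<inter> f = {}")
        (simp_all only: mult.assoc mult_2 mult_1 add_0_right simp_thms if_True if_False)
  qed
  then have "(\<Sum>f\<in>core ls. 2 ^ card (f \<inter> \<Union>(greedy ls)) * m f +
       (if e \<inter> f \<noteq> {} then 2 ^ card (f \<inter> \<Union>(greedy ls)) * m f else 0))
      \<le> (\<Sum>f\<in>core ls. 2 ^ card (f \<inter> \<Union>(insert e (greedy ls))) * m f)"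
    by (rule sum_mono)
  then show ?thesis by (simp add: sum.distrib sum.inter_filter)
qed

lemma potential_coin:
  fixes y y' :: "'v set \<times> draw \<Rightarrow> real"
  assumes agree: "\<And>i. i \<in> set ls \<Longrightarrow> y i = y' i"
    and val: "y (e, Sample) = y' (e, Reward)" "0 \<le> y (e, Sample)"
    and nonneg: "\<And>i. i \<in> set ls \<Longrightarrow> 0 \<le> y i"
    and edges: "\<And>i. i \<in> set ls \<Longrightarrow> card (fst i) = 2" "e \<noteq> {}"
    and new: "e \<notin> fst ` set ls"
  shows "potential y ls + potential y' ls \<le> potential y ((e, Sample) # ls) + potential y' ((e, Reward) # ls)"
proof (cases "e \<inter> \<Union>(greedy ls) = {}")
  case False
  then show ?thesis by (simp add: potential_def)
next
  case True
  define x where "x = y (e, Sample)"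
  define K :: "'v set \<Rightarrow> real" where "K f = 2 ^ card (f \<inter> \<Union>(greedy ls))" for f
  define m where "m = last_val y ls"
  define W where "W = (\<Sum>f\<in>greedy ls. y (f, Sample))"
  let ?B = "{f \<in> core ls. e \<inter> f \<noteq> {}}"
  have m': "last_val y' ls = m" unfolding m_def using last_val_cong agree by (metis ext)
  have edge: "card f = 2" if "f \<in> core ls" for f
    using that core_subset[of ls] accepted_subset[of f ls] edges(1)[of "(f, Reward)"] by auto
  have m0: "0 \<le> m f" if "f \<in> core ls" for f
    using last_val_in[OF that, of y] edge[OF that] nonneg unfolding m_def by fastforce
  have "e \<notin> greedy ls" using True edges by auto
  then have "potential y ((e, Sample) # ls) =
      (\<Sum>f\<in>core ls. 2 ^ card (f \<inter> \<Union>(insert e (greedy ls))) * m f) - (x + W)"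
    using True by (simp add: potential_def x_def W_def m_def)
  moreover have "(\<Sum>f\<in>core ls. K f * m f) + (\<Sum>f\<in>?B. K f * m f)
      \<le> (\<Sum>f\<in>core ls. 2 ^ card (f \<inter> \<Union>(insert e (greedy ls))) * m f)"
    unfolding K_def by (rule core_sum_insert_ge) (use edge m0 True in \<open>simp_all add: card_ge_0_finite\<close>)
  ultimately have S: "(\<Sum>f\<in>core ls. K f * m f) + (\<Sum>f\<in>?B. K f * m f) - (x + W) \<le> potential y ((e, Sample) # ls)"
    by simp
  have "potential y ls = (\<Sum>f\<in>core ls. K f * m f) - W"
    by (simp add: potential_def K_def m_def W_def)
  moreover have "potential y' ls = potential y ls"
    using potential_cong[of ls y y'] agree by simp
  moreover have "(\<Sum>f\<in>core ls. K f * m f) - W + x - (\<Sum>f\<in>?B. K f * m f) \<le> potential y' ((e, Reward) # ls)"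
  proof -
    have W': "(\<Sum>f\<in>greedy ls. y' (f, Sample)) = W"
      unfolding W_def using agree greedy_subset by (metis (no_types, lifting) sum.cong)
    show ?thesis
    proof (cases "e \<inter> \<Union>(core ls) = {}")
      case e: True
      then have "e \<notin> core ls" using edges by auto
      moreover have "last_val y' ((e, Reward) # ls) f = m f" if "f \<in> core ls" for f
        using that e by (auto simp: m')
      moreover have "last_val y' ((e, Reward) # ls) e = x"
        using True edges val by (simp add: x_def)
      ultimately have "potential y' ((e, Reward) # ls) = (\<Sum>f\<in>core ls. K f * m f) + x - W"
        using True e W' by (simp add: potential_def K_def)
      moreover have "?B = {}" using e by auto
      then have "(\<Sum>f\<in>?B. K f * m f) = 0" by (metis sum.empty)
      ultimately show ?thesis by linarith
    next
      case e: False
      have "potential y' ((e, Reward) # ls) = (\<Sum>f\<in>core ls. K f * (if e \<inter> f \<noteq> {} then x else m f)) - W"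
        using True e W' val(1) by (simp add: potential_def K_def x_def m' cong: if_cong)
      also have "(\<Sum>f\<in>core ls. K f * (if e \<inter> f \<noteq> {} then x else m f))
         = (\<Sum>f\<in>core ls. K f * m f) + (\<Sum>f\<in>core ls. if e \<inter> f \<noteq> {} then K f * x - K f * m f else 0)"
        unfolding sum.distrib[symmetric] by (intro sum.cong) auto
      also have "(\<Sum>f\<in>core ls. if e \<inter> f \<noteq> {} then K f * x - K f * m f else 0)
         = (\<Sum>f\<in>?B. K f * x) - (\<Sum>f\<in>?B. K f * m f)"
        unfolding sum_subtractf[symmetric] by (simp add: sum.inter_filter)
      finally have eq: "potential y' ((e, Reward) # ls) = (\<Sum>f\<in>core ls. K f * m f)
         + ((\<Sum>f\<in>?B. K f * x) - (\<Sum>f\<in>?B. K f * m f)) - W" .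
      obtain f where "f \<in> ?B" using e by auto
      moreover have "x \<le> K f * x" "\<And>f. 0 \<le> K f * x"
        using val by (auto simp: K_def x_def mult_le_cancel_right1)
      ultimately have "x \<le> (\<Sum>f\<in>?B. K f * x)"
        using member_le_sum[of f ?B "\<lambda>f. K f * x"] by force
      then show ?thesis using eq by simp
    qed
  qed
  ultimately show ?thesis using S by linarith
qed

lemma potential_second:
  fixes y :: "'v set \<times> draw \<Rightarrow> real"
  assumes seen: "(e, other d) \<in> set ls"
    and nonneg: "0 \<le> y (e, d)" "\<And>i. i \<in> set ls \<Longrightarrow> y (e, d) \<le> y i"
    and edges: "\<And>i. i \<in> set ls \<Longrightarrow> card (fst i) = 2"
  shows "potential y ls \<le> potential y ((e, d) # ls)"
proof (cases "e \<inter> \<Union>(greedy ls) = {}")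
  case False
  then show ?thesis by (simp add: potential_def)
next
  case True
  have ne: "e \<noteq> {}" using edges[OF seen] by auto
  have d: "d = Sample"
    using greedy_meets[of e ls] seen True ne by (cases d) auto
  define m where "m = last_val y ls"
  let ?B = "{f \<in> core ls. e \<inter> f \<noteq> {}}"
  have edge: "card f = 2" if "f \<in> core ls" for f
    using that core_subset[of ls] accepted_subset[of f ls] edges[of "(f, Reward)"] by auto
  have m0: "0 \<le> m f" if "f \<in> core ls" for f
    using last_val_in[OF that, of y] edge[OF that] nonneg unfolding m_def by fastforce
  have m: "y (e, d) \<le> m f" if "f \<in> core ls" for f
    using last_val_in[OF that, of y] edge[OF that] nonneg unfolding m_def by fastforce
  have "e \<in> accepted ls" using open_reward_accepted[of e ls] seen True d by simp
  then obtain f where f: "f \<in> ?B" using accepted_meets_core ne by blast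
  have "e \<notin> greedy ls" using True ne by auto
  then have "potential y ((e, d) # ls) =
      (\<Sum>f\<in>core ls. 2 ^ card (f \<inter> \<Union>(insert e (greedy ls))) * m f) - (y (e, d) + (\<Sum>f\<in>greedy ls. y (f, Sample)))"
    using True d by (simp add: potential_def m_def)
  moreover have "(\<Sum>f\<in>core ls. 2 ^ card (f \<inter> \<Union>(greedy ls)) * m f) + (\<Sum>f\<in>?B. 2 ^ card (f \<inter> \<Union>(greedy ls)) * m f)
      \<le> (\<Sum>f\<in>core ls. 2 ^ card (f \<inter> \<Union>(insert e (greedy ls))) * m f)"
    by (rule core_sum_insert_ge) (use edge m0 True in \<open>simp_all add: card_ge_0_finite\<close>)
  moreover have "y (e, d) \<le> (\<Sum>f\<in>?B. 2 ^ card (f \<inter> \<Union>(greedy ls)) * m f)"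
  proof -
    have *: "0 \<le> m g" if "g \<in> ?B" for g using that m[of g] nonneg(1) by simp
    have "y (e, d) \<le> 1 * m f" using m f by simp
    also have "\<dots> \<le> 2 ^ card (f \<inter> \<Union>(greedy ls)) * m f"
      using *[OF f] by (intro mult_right_mono) auto
    also have "\<dots> \<le> (\<Sum>f\<in>?B. 2 ^ card (f \<inter> \<Union>(greedy ls)) * m f)"
      using * f by (intro member_le_sum) auto
    finally show ?thesis .
  qed
  ultimately show ?thesis by (simp add: potential_def m_def)
qed

lemma sum_Pow_insert:
  assumes "finite A" "e \<in> A"
  shows "(\<Sum>c\<in>Pow A. F c) = (\<Sum>c\<in>Pow (A - {e}). F c + F (insert e c) :: real)"
proof -
  have "Pow A = Pow (A - {e}) \<union> insert e ` Pow (A - {e})"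
    using assms Pow_insert[of e "A - {e}"] by (simp add: insert_absorb)
  moreover have "Pow (A - {e}) \<inter> insert e ` Pow (A - {e}) = {}" by auto
  moreover have "inj_on (insert e) (Pow (A - {e}))"
    by (auto simp: inj_on_def)
  ultimately show ?thesis
    using assms by (simp add: sum.union_disjoint sum.reindex sum.distrib)
qed

lemma sum_potential_nonneg:
  fixes x :: "'v set \<times> draw \<Rightarrow> real"
  assumes "finite E" "distinct ls" "set ls \<subseteq> E \<times> {Sample, Reward}"
    and "sorted_wrt (\<lambda>i j. x i \<le> x j) ls"
    and "\<And>i. i \<in> set ls \<Longrightarrow> 0 \<le> x i"
    and "\<And>e. e \<in> E \<Longrightarrow> card e = 2"
  shows "0 \<le> (\<Sum>c\<in>Pow E. potential (x \<circ> flip c) (map (flip c) ls))"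
  using assms(2-5)
proof (induction ls)
  case Nil
  then show ?case by (simp add: potential_def)
next
  case (Cons i ls)
  obtain e d where i: "i = (e, d)" by (cases i)
  have e: "e \<in> E" using Cons.prems i by auto
  have "(\<Sum>c\<in>Pow E. potential (x \<circ> flip c) (map (flip c) ls))
      \<le> (\<Sum>c\<in>Pow E. potential (x \<circ> flip c) (map (flip c) (i # ls)))"
  proof (cases "(e, other d) \<in> set ls")
    case True
    show ?thesis
    proof (rule sum_mono)
      fix c
      define d' where "d' = (if e \<in> c then other d else d)"
      have f: "flip c i = (e, d')" "flip c (e, d') = i" by (auto simp: flip_def i d'_def)
      have "(e, other d') = flip c (e, other d)" by (auto simp: flip_def d'_def)
      then have "(e, other d') \<in> set (map (flip c) ls)" using True by (metis image_eqI set_map)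
      then have "potential (x \<circ> flip c) (map (flip c) ls) \<le> potential (x \<circ> flip c) ((e, d') # map (flip c) ls)"
        by (rule potential_second) (use Cons.prems assms(6) f in auto)
      then show "potential (x \<circ> flip c) (map (flip c) ls) \<le> potential (x \<circ> flip c) (map (flip c) (i # ls))"
        using f by simp
    qed
  next
    case False
    have new: "e \<notin> fst ` set ls"
    proof
      assume "e \<in> fst ` set ls"
      then obtain d' where "(e, d') \<in> set ls" by auto
      then show False using False Cons.prems i by (cases d; cases d') auto
    qed
    have "potential (x \<circ> flip c) (map (flip c) ls) + potential (x \<circ> flip (insert e c)) (map (flip (insert e c)) ls)
      \<le> potential (x \<circ> flip c) (map (flip c) (i # ls))
         + potential (x \<circ> flip (insert e c)) (map (flip (insert e c)) (i # ls))"
      if c: "c \<subseteq> E - {e}" for c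
    proof -
      let ?c = "insert e c"
      have ne: "e \<notin> c" using c by auto
      have eq: "flip ?c j = flip c j" if "j \<in> set ls" for j
        using that new by (force simp: flip_def)
      have maps: "map (flip ?c) ls = map (flip c) ls" using eq by simp
      have eq': "(x \<circ> flip c) j = (x \<circ> flip ?c) j" if "j \<in> set (map (flip c) ls)" for j
        using that new by (force simp: flip_def)
      have f: "flip c i = (e, d)" "flip ?c i = (e, other d)" "flip c (e, d) = i" "flip ?c (e, other d) = i"
        using ne by (auto simp: flip_def i)
      have "0 \<le> x i" using Cons.prems by simp
      have new': "e \<notin> fst ` set (map (flip c) ls)" using new by (force simp: flip_def)
      have n0: "0 \<le> (x \<circ> flip c) j" if "j \<in> set (map (flip c) ls)" for j
        using that Cons.prems by auto
      have ed: "card (fst j) = 2" if "j \<in> set (map (flip c) ls)" for j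
        using that Cons.prems assms(6) by auto
      have ene: "e \<noteq> {}" using assms(6)[OF e] by auto
      show ?thesis
      proof (cases d)
        case Sample
        have "potential (x \<circ> flip c) (map (flip c) ls) + potential (x \<circ> flip ?c) (map (flip c) ls)
          \<le> potential (x \<circ> flip c) ((e, Sample) # map (flip c) ls) + potential (x \<circ> flip ?c) ((e, Reward) # map (flip c) ls)"
          using f Sample \<open>0 \<le> x i\<close> n0 ed ene new' eq' by (intro potential_coin) auto
        then show ?thesis unfolding maps list.map f using Sample by simp
      next
        case Reward
        have "potential (x \<circ> flip ?c) (map (flip c) ls) + potential (x \<circ> flip c) (map (flip c) ls)
          \<le> potential (x \<circ> flip ?c) ((e, Sample) # map (flip c) ls) + potential (x \<circ> flip c) ((e, Reward) # map (flip c) ls)"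
        proof (rule potential_coin)
          show "0 \<le> (x \<circ> flip ?c) j" if "j \<in> set (map (flip c) ls)" for j
            using n0[OF that] eq'[OF that] by simp
        qed (use f Reward \<open>0 \<le> x i\<close> ed ene new' eq' in auto)
        then show ?thesis unfolding maps list.map f using Reward by simp
      qed
    qed
    then show ?thesis
      unfolding sum_Pow_insert[OF assms(1) e] by (intro sum_mono) auto
  qed
  moreover have "0 \<le> (\<Sum>c\<in>Pow E. potential (x \<circ> flip c) (map (flip c) ls))"
    using Cons.prems by (intro Cons.IH) auto
  ultimately show ?case by linarith
qed

subsection \<open>Comparing matchings\<close>

lemma sum_charge_le:
  fixes a b :: "'v set \<Rightarrow> real"
  assumes "finite H" "finite N" "disjoint H"
    and near: "\<And>f. f \<in> H \<Longrightarrow> \<exists>g\<in>N. f \<inter> g \<noteq> {} \<and> a f \<le> b g"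
    and N: "\<And>g. g \<in> N \<Longrightarrow> card g = 2" "\<And>g. g \<in> N \<Longrightarrow> 0 \<le> b g"
  shows "(\<Sum>f\<in>H. a f) \<le> 2 * (\<Sum>g\<in>N. b g)"
proof -
  obtain \<phi> where \<phi>: "\<And>f. f \<in> H \<Longrightarrow> \<phi> f \<in> N \<and> f \<inter> \<phi> f \<noteq> {} \<and> a f \<le> b (\<phi> f)"
    using near by metis
  have "(\<Sum>f\<in>H. a f) \<le> (\<Sum>f\<in>H. b (\<phi> f))"
    using \<phi> by (intro sum_mono) auto
  also have "\<dots> = (\<Sum>g\<in>N. \<Sum>f\<in>{f \<in> H. \<phi> f = g}. b (\<phi> f))"
    using assms(1,2) \<phi> by (intro sum.group[symmetric]) auto
  also have "\<dots> \<le> (\<Sum>g\<in>N. 2 * b g)"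
  proof (rule sum_mono)
    fix g assume g: "g \<in> N"
    let ?F = "{f \<in> H. \<phi> f = g}"
    have "\<exists>v. v \<in> f \<and> v \<in> g" if "f \<in> ?F" for f
      using \<phi>[of f] that by auto
    then obtain v where v: "\<And>f. f \<in> ?F \<Longrightarrow> v f \<in> f \<and> v f \<in> g" by metis
    have "inj_on v ?F"
    proof
      fix f f' assume ff: "f \<in> ?F" "f' \<in> ?F" "v f = v f'"
      then have "v f \<in> f \<inter> f'" using v by (metis IntI)
      then show "f = f'" using assms(3) ff unfolding disjoint_def by blast
    qed
    moreover have "finite g" using N(1)[OF g] card_ge_0_finite by force
    ultimately have "card ?F \<le> card g" using v by (intro card_inj_on_le) auto
    then have "real (card ?F) * b g \<le> 2 * b g"
      using N g by (intro mult_right_mono) auto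
    then show "(\<Sum>f\<in>?F. b (\<phi> f)) \<le> 2 * b g" by simp
  qed
  finally show ?thesis by (simp add: sum_distrib_left)
qed

lemma online_matching_snoc:
  "online_matching P (\<sigma> @ [e]) =
     (if P e \<and> e \<inter> \<Union>(online_matching P \<sigma>) = {} then insert e (online_matching P \<sigma>)
      else online_matching P \<sigma>)"
  by (simp add: online_matching_def)

lemma online_matching_subset: "online_matching P \<sigma> \<subseteq> {e \<in> set \<sigma>. P e}"
proof (induction \<sigma> rule: rev_induct)
  case Nil
  then show ?case by (simp add: online_matching_def)
next
  case (snoc e \<sigma>)
  then show ?case by (auto simp: online_matching_snoc)
qed

lemma online_matching_maximal:
  "e \<in> set \<sigma> \<Longrightarrow> P e \<Longrightarrow> e \<noteq> {} \<Longrightarrow> e \<inter> \<Union>(online_matching P \<sigma>) \<noteq> {}"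
proof (induction \<sigma> rule: rev_induct)
  case (snoc d \<sigma>)
  have sub: "online_matching P \<sigma> \<subseteq> online_matching P (\<sigma> @ [d])"
    by (auto simp: online_matching_snoc)
  show ?case
  proof (cases "e \<inter> \<Union>(online_matching P \<sigma>) = {}")
    case True
    then have "e = d" using snoc by auto
    then have "e \<in> online_matching P (\<sigma> @ [d])"
      using True snoc.prems by (simp add: online_matching_snoc)
    then show ?thesis using snoc.prems by blast
  next
    case False
    then show ?thesis using sub by blast
  qed
qed simp

lemma online_matching_cong:
  assumes "\<And>e. e \<in> set \<sigma> \<Longrightarrow> P e = Q e"
  shows "online_matching P \<sigma> = online_matching Q \<sigma>"
  unfolding online_matching_def using assms by (intro fold_cong) auto

lemma greedy_dominates:
  assumes "sorted_wrt (\<lambda>i j. y i \<le> y j) ls" "(e, Sample) \<in> set ls" "e \<noteq> {}"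
  shows "\<exists>f\<in>greedy ls. e \<inter> f \<noteq> {} \<and> (y (e, Sample) :: real) \<le> y (f, Sample)"
  using assms
proof (induction ls)
  case (Cons i ls)
  show ?case
  proof (cases "(e, Sample) \<in> set ls")
    case True
    then show ?thesis using Cons greedy_mono[of ls i] by fastforce
  next
    case False
    then have i: "i = (e, Sample)" using Cons.prems by auto
    show ?thesis
    proof (cases "e \<inter> \<Union>(greedy ls) = {}")
      case True
      then show ?thesis using i Cons.prems by auto
    next
      case False
      then obtain f where f: "f \<in> greedy ls" "e \<inter> f \<noteq> {}" by blast
      then have "y (e, Sample) \<le> y (f, Sample)"
        using Cons.prems greedy_subset[of f ls] i by auto
      then show ?thesis using f greedy_mono[of ls i] by blast
    qed
  qed
qed simp

lemma finite_matchings: "finite E \<Longrightarrow> finite {N. matching E N}"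
  by (rule finite_subset[of _ "Pow E"]) (auto simp: matching_def)

lemma opt_le_greedy:
  fixes s :: "'v set \<Rightarrow> real"
  assumes "finite E" and edges: "\<And>e. e \<in> E \<Longrightarrow> card e = 2"
    and "set ls = E \<times> {Sample, Reward}" "sorted_wrt (\<lambda>i j. y i \<le> y j) ls"
    and "\<And>e. e \<in> E \<Longrightarrow> y (e, Sample) = s e" "\<And>e. e \<in> E \<Longrightarrow> 0 \<le> s e"
  shows "opt E s \<le> 2 * (\<Sum>f\<in>greedy ls. y (f, Sample))"
proof -
  have gE: "g \<in> E" if "g \<in> greedy ls" for g
    using greedy_subset[OF that] assms(3) by auto
  have "weight s N \<le> 2 * (\<Sum>f\<in>greedy ls. y (f, Sample))" if N: "matching E N" for N
    unfolding weight_def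
  proof (rule sum_charge_le)
    show "\<exists>g\<in>greedy ls. f \<inter> g \<noteq> {} \<and> s f \<le> y (g, Sample)" if "f \<in> N" for f
    proof -
      have "f \<in> E" using that N by (auto simp: matching_def)
      moreover from this have "f \<noteq> {}" using edges by force
      ultimately show ?thesis
        using greedy_dominates[OF assms(4), of f] assms(3,5) by force
    qed
    show "finite N" "disjoint N"
      using N finite_subset[OF _ assms(1)] by (auto simp: matching_def)
    show "card g = 2" "0 \<le> y (g, Sample)" if "g \<in> greedy ls" for g
      using edges assms(5,6)[of g] gE[OF that] by auto
  qed simp
  moreover have "finite {N. matching E N}" using assms(1) by (rule finite_matchings)
  moreover have "matching E {}" by (simp add: matching_def)
  ultimately show ?thesis unfolding opt_def by (subst Max_le_iff) auto
qed

lemma potential_le_online: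
  fixes y :: "'v set \<times> draw \<Rightarrow> real"
  assumes edges: "\<And>e. e \<in> E \<Longrightarrow> card e = 2"
    and ls: "set ls \<subseteq> E \<times> {Sample, Reward}" "sorted_wrt (\<lambda>i j. y i \<le> y j) ls"
    and "set \<sigma> = E" and nonneg: "\<And>i. i \<in> set ls \<Longrightarrow> 0 \<le> y i"
  shows "potential y ls \<le>
     8 * (\<Sum>e\<in>online_matching (\<lambda>e. e \<in> accepted ls) \<sigma>. y (e, Reward)) - (\<Sum>f\<in>greedy ls. y (f, Sample))"
proof -
  let ?M = "online_matching (\<lambda>e. e \<in> accepted ls) \<sigma>"
  have coreE: "f \<in> accepted ls" "f \<in> E" if "f \<in> core ls" for f
    using core_subset[of ls] accepted_subset[of f ls] that ls by auto
  have card: "card f = 2" if "f \<in> core ls" for f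
    using coreE[OF that] edges by simp
  have "(\<Sum>f\<in>core ls. 2 ^ card (f \<inter> \<Union>(greedy ls)) * last_val y ls f) \<le> (\<Sum>f\<in>core ls. 4 * last_val y ls f)"
  proof (intro sum_mono mult_right_mono)
    fix f assume f: "f \<in> core ls"
    have "finite f" using card[OF f] card_ge_0_finite by force
    then have "card (f \<inter> \<Union>(greedy ls)) \<le> 2" using card[OF f] by (metis card_mono inf_le1)
    then show "2 ^ card (f \<inter> \<Union>(greedy ls)) \<le> (4::real)"
      using power_increasing[of _ 2 "2::real"] by fastforce
    have "f \<noteq> {}" using card[OF f] by auto
    then show "0 \<le> last_val y ls f" using last_val_in[OF f, of y] nonneg by auto
  qed
  also have "\<dots> = 4 * (\<Sum>f\<in>core ls. last_val y ls f)" by (simp add: sum_distrib_left)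
  also have "(\<Sum>f\<in>core ls. last_val y ls f) \<le> 2 * (\<Sum>e\<in>?M. y (e, Reward))"
  proof (rule sum_charge_le)
    show "finite ?M" using online_matching_subset by (rule finite_subset) simp
    show "card g = 2" "0 \<le> y (g, Reward)" if "g \<in> ?M" for g
      using that online_matching_subset[of "\<lambda>e. e \<in> accepted ls" \<sigma>] assms(4) edges nonneg
        accepted_subset[of g ls] by auto
    show "\<exists>g\<in>?M. f \<inter> g \<noteq> {} \<and> last_val y ls f \<le> y (g, Reward)" if f: "f \<in> core ls" for f
    proof -
      have "f \<noteq> {}" using card[OF f] by auto
      then have "f \<inter> \<Union>?M \<noteq> {}"
        using coreE[OF f] assms(4) by (intro online_matching_maximal) auto
      then obtain g where g: "g \<in> ?M" "f \<inter> g \<noteq> {}" by blast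
      then have "g \<in> accepted ls" using online_matching_subset by blast
      then show ?thesis using last_val_le[OF ls(2) f, of g] g by blast
    qed
  qed (simp_all add: disjoint_core)
  finally show ?thesis by (simp add: potential_def)
qed

subsection \<open>Stable sorting and precedence\<close>

lemma precedes_Nil [simp]: "\<not> precedes [] a b"
  by (simp add: precedes_def)

lemma precedes_Cons: "precedes (x # xs) a b \<longleftrightarrow> x = a \<and> b \<in> set xs \<or> precedes xs a b"
proof
  assume "precedes (x # xs) a b"
  then obtain i j where "i < j" "j < length (x # xs)" "(x # xs) ! i = a" "(x # xs) ! j = b"
    unfolding precedes_def by blast
  then show "x = a \<and> b \<in> set xs \<or> precedes xs a b"
    unfolding precedes_def by (cases i; cases j) auto
next
  assume "x = a \<and> b \<in> set xs \<or> precedes xs a b"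
  then show "precedes (x # xs) a b"
  proof
    assume "x = a \<and> b \<in> set xs"
    then obtain j where "j < length xs" "xs ! j = b" "x = a" by (auto simp: in_set_conv_nth)
    then show ?thesis unfolding precedes_def by (intro exI[of _ 0] exI[of _ "Suc j"]) auto
  next
    assume "precedes xs a b"
    then obtain i j where "i < j" "j < length xs" "xs ! i = a" "xs ! j = b"
      unfolding precedes_def by blast
    then show ?thesis unfolding precedes_def by (intro exI[of _ "Suc i"] exI[of _ "Suc j"]) auto
  qed
qed

lemma precedes_in_set: "precedes xs a b \<Longrightarrow> a \<in> set xs \<and> b \<in> set xs"
  by (auto simp: precedes_def)

lemma precedes_append:
  "precedes (xs @ ys) a b \<longleftrightarrow> precedes xs a b \<or> precedes ys a b \<or> a \<in> set xs \<and> b \<in> set ys"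
  by (induction xs) (auto simp: precedes_Cons)

lemma precedes_rev: "precedes (rev xs) a b \<longleftrightarrow> precedes xs b a"
  by (induction xs) (auto simp: precedes_Cons precedes_append)

lemma precedes_filter: "P a \<Longrightarrow> P b \<Longrightarrow> precedes (filter P xs) a b \<longleftrightarrow> precedes xs a b"
  by (induction xs) (auto simp: precedes_Cons)

lemma precedes_total:
  "a \<in> set xs \<Longrightarrow> b \<in> set xs \<Longrightarrow> a \<noteq> b \<Longrightarrow> precedes xs a b \<or> precedes xs b a"
  by (induction xs) (auto simp: precedes_Cons)

lemma precedes_sorted: "sorted (map k xs) \<Longrightarrow> precedes xs a b \<Longrightarrow> k a \<le> k b"
  by (induction xs) (auto simp: precedes_Cons)

lemma precedes_sort_key:
  assumes "a \<in> set xs" "b \<in> set xs" "a \<noteq> b"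
  shows "precedes (sort_key k xs) a b \<longleftrightarrow> k a < k b \<or> k a = k b \<and> precedes xs a b"
proof (cases "k a = k b")
  case True
  have "precedes (sort_key k xs) a b \<longleftrightarrow> precedes (filter (\<lambda>z. k z = k a) (sort_key k xs)) a b"
    using True by (simp add: precedes_filter)
  also have "filter (\<lambda>z. k z = k a) (sort_key k xs) = filter (\<lambda>z. k z = k a) xs"
    using sort_key_stable[of k "k a" xs] by (simp add: eq_commute)
  finally show ?thesis using True by (simp add: precedes_filter)
next
  case False
  have "sorted (map k (sort_key k xs))" by simp
  then show ?thesis
    using False precedes_sorted[of k "sort_key k xs"] precedes_total[of a "sort_key k xs" b] assms
    by (metis order.not_eq_order_implies_strict order_less_le_trans less_irrefl set_sort)
qed

lemma accepted_iff:
  assumes "distinct ls"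
  shows "e \<in> accepted ls \<longleftrightarrow> (e, Reward) \<in> set ls \<and>
     (\<forall>f\<in>greedy ls. e \<inter> f \<noteq> {} \<longrightarrow> precedes ls (f, Sample) (e, Reward))"
  using assms
proof (induction ls)
  case (Cons i ls)
  obtain g d where i: "i = (g, d)" by (cases i)
  have new: "(g, d) \<notin> set ls" "distinct ls" using Cons.prems i by auto
  have fresh: "(f, Sample) \<noteq> (g, d)" if "f \<in> greedy ls" for f
    using greedy_subset[OF that] new by auto
  show ?case
  proof (cases "i = (e, Reward)")
    case True
    then have "e \<notin> accepted ls" using new i accepted_subset[of e ls] by auto
    moreover have "\<not> precedes (i # ls) a (e, Reward)" for a
      using new i True precedes_in_set[of ls a "(e, Reward)"] by (auto simp: precedes_Cons)
    ultimately show ?thesis using True by auto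
  next
    case False
    have IH: "e \<in> accepted (i # ls) \<longleftrightarrow> (e, Reward) \<in> set ls \<and>
       (\<forall>f\<in>greedy ls. e \<inter> f \<noteq> {} \<longrightarrow> precedes ls (f, Sample) (e, Reward))"
      using False Cons.IH[OF new(2)] i by auto
    have old: "precedes (i # ls) (f, Sample) (e, Reward) \<longleftrightarrow> precedes ls (f, Sample) (e, Reward)"
      if "f \<in> greedy ls" for f
      using fresh[OF that] i by (auto simp: precedes_Cons)
    show ?thesis
    proof (cases "d = Sample \<and> g \<inter> \<Union>(greedy ls) = {}")
      case True
      have "precedes (i # ls) (g, Sample) (e, Reward)" if "(e, Reward) \<in> set ls"
        using that True i by (simp add: precedes_Cons)
      moreover have "greedy (i # ls) = insert g (greedy ls)" using True i by simp
      ultimately show ?thesis using IH old False by auto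
    next
      case nadd: False
      then have "greedy (i # ls) = greedy ls" using i by auto
      then show ?thesis using IH old False by auto
    qed
  qed
qed simp

subsection \<open>The algorithm in terms of the merged order\<close>

definition val :: "('v set \<Rightarrow> real) \<Rightarrow> ('v set \<Rightarrow> real) \<Rightarrow> 'v set \<times> draw \<Rightarrow> real" where
  "val s r i = (case snd i of Sample \<Rightarrow> s (fst i) | Reward \<Rightarrow> r (fst i))"

lemma val_simps [simp]: "val s r (e, Sample) = s e" "val s r (e, Reward) = r e"
  by (simp_all add: val_def)

definition draw_order :: "('v set \<times> draw \<Rightarrow> real) \<Rightarrow> ('v set \<times> draw) list \<Rightarrow> ('v set \<times> draw) list" where
  "draw_order x \<tau> = rev (sort_key (\<lambda>i. - x i) \<tau>)"

lemma sort_key_map: "sort_key k (map f xs) = map f (sort_key (k \<circ> f) xs)"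
proof (induction xs)
  case (Cons x xs)
  have "insort_key k (f x) (map f ys) = map f (insort_key (k \<circ> f) x ys)" for ys
    by (induction ys) auto
  then show ?case using Cons by (simp add: comp_def)
qed simp

lemma insort_key_cong:
  "(\<And>z. z \<in> insert x (set ys) \<Longrightarrow> k z = k' z) \<Longrightarrow> insort_key k x ys = insort_key k' x ys"
  by (induction ys) auto

lemma sort_key_cong_set: "(\<And>x. x \<in> set xs \<Longrightarrow> k x = k' x) \<Longrightarrow> sort_key k xs = sort_key k' xs"
proof (induction xs)
  case (Cons x xs)
  then have "sort_key k xs = sort_key k' xs" by auto
  then show ?case using Cons.prems insort_key_cong[of x "sort_key k' xs" k k'] by simp
qed simp

lemma set_draw_order [simp]: "set (draw_order x \<tau>) = set \<tau>"
  by (simp add: draw_order_def)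

lemma distinct_draw_order [simp]: "distinct (draw_order x \<tau>) = distinct \<tau>"
  by (simp add: draw_order_def)

lemma sorted_draw_order: "sorted_wrt (\<lambda>i j. x i \<le> x j) (draw_order x \<tau>)"
proof -
  have "sorted (map (\<lambda>i. - x i) (sort_key (\<lambda>i. - x i) \<tau>))" by simp
  then show ?thesis by (simp add: draw_order_def sorted_wrt_rev sorted_wrt_map)
qed

lemma draw_order_flip:
  assumes "\<And>i. i \<in> set \<tau> \<Longrightarrow> y (flip c i) = x i"
  shows "draw_order y (map (flip c) \<tau>) = map (flip c) (draw_order x \<tau>)"
proof -
  have "sort_key (\<lambda>i. - y i) (map (flip c) \<tau>) = map (flip c) (sort_key (\<lambda>i. - x i) \<tau>)"
    unfolding sort_key_map using assms by (intro arg_cong2[of _ _ _ _ map] sort_key_cong_set) auto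
  then show ?thesis by (simp add: draw_order_def rev_map)
qed

lemma sample_matching_eq: "sample_matching \<tau> s = greedy (draw_order (val s r) \<tau>)"
proof -
  let ?L = "sort_key (\<lambda>i. - val s r i) \<tau>"
  have "greedy_order \<tau> s = map fst (sort_key ((\<lambda>e. - s e) \<circ> fst) (filter (\<lambda>t. snd t = Sample) \<tau>))"
    by (simp add: greedy_order_def sort_key_map)
  also have "sort_key ((\<lambda>e. - s e) \<circ> fst) (filter (\<lambda>t. snd t = Sample) \<tau>)
     = sort_key (\<lambda>i. - val s r i) (filter (\<lambda>t. snd t = Sample) \<tau>)"
    by (intro sort_key_cong_set) (auto simp: val_def)
  finally have order: "greedy_order \<tau> s = map fst (filter (\<lambda>t. snd t = Sample) ?L)"
    by (simp add: filter_sort)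
  have "fold (\<lambda>e N. if disjoint (insert e N) then insert e N else N)
      (map fst (filter (\<lambda>t. snd t = Sample) L)) {} = greedy (rev L)" for L :: "('v set \<times> draw) list"
  proof (induction L rule: rev_induct)
    case (snoc i L)
    obtain e d where i: "i = (e, d)" by (cases i)
    let ?N = "greedy (rev L)"
    have "(if disjoint (insert e ?N) then insert e ?N else ?N) =
        (if e \<inter> \<Union>?N = {} then insert e ?N else ?N)"
    proof (cases "e \<in> ?N")
      case True
      then show ?thesis by (simp add: insert_absorb)
    next
      case False
      then have "disjoint (insert e ?N) \<longleftrightarrow> e \<inter> \<Union>?N = {}"
        using disjoint_greedy[of "rev L"] by (auto simp: pairwise_insert disjnt_def)
      then show ?thesis by simp
    qed
    then show ?case using snoc i by simp
  qed simp
  then show ?thesis by (simp add: sample_matching_def order draw_order_def)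
qed

lemma price_eq:
  assumes "disjoint N" "f \<in> N" "u \<in> f"
  shows "price s N u = s f"
proof -
  have "(THE e. e \<in> N \<and> u \<in> e) = f"
  proof (rule the_equality)
    show "g = f" if "g \<in> N \<and> u \<in> g" for g
      using assms that by (metis disjnt_iff pairwiseD)
  qed (use assms in simp)
  then show ?thesis using assms by (auto simp: price_def)
qed

lemma clears_iff_accepted:
  assumes \<tau>: "\<tau> \<in> tie_orders E" and e: "e \<in> E" and r: "0 \<le> r e"
  shows "(\<forall>u\<in>e. clears \<tau> s r (sample_matching \<tau> s) e u) \<longleftrightarrow> e \<in> accepted (draw_order (val s r) \<tau>)"
proof -
  define ls where "ls = draw_order (val s r) \<tau>"
  have \<tau>': "distinct \<tau>" "set \<tau> = E \<times> {Sample, Reward}"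
    using \<tau> by (auto simp: tie_orders_def permutations_of_setD)
  have N: "sample_matching \<tau> s = greedy ls"
    unfolding ls_def by (rule sample_matching_eq)
  have gE: "(f, Sample) \<in> set \<tau>" if "f \<in> greedy ls" for f
    using greedy_subset[OF that] by (simp add: ls_def)
  have eR: "(e, Reward) \<in> set \<tau>" using e \<tau>' by simp
  have prec: "precedes ls (f, Sample) (e, Reward) \<longleftrightarrow>
      r e > s f \<or> r e = s f \<and> precedes \<tau> (e, Reward) (f, Sample)" if "f \<in> greedy ls" for f
    using precedes_sort_key[OF eR gE[OF that], of "\<lambda>i. - val s r i"]
    by (simp add: ls_def draw_order_def precedes_rev)
  have price: "price s (greedy ls) u = s f" if "f \<in> greedy ls" "u \<in> f" for f u
    using that by (intro price_eq disjoint_greedy)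
  have "clears \<tau> s r (greedy ls) e u \<longleftrightarrow>
      (\<forall>f\<in>greedy ls. u \<in> f \<longrightarrow> precedes ls (f, Sample) (e, Reward))" for u
  proof (cases "u \<in> \<Union>(greedy ls)")
    case True
    then obtain f where f: "f \<in> greedy ls" "u \<in> f" by blast
    have uniq: "g = f" if "g \<in> greedy ls" "u \<in> g" for g
      using that f disjoint_greedy[of ls] unfolding disjoint_def by blast
    have "clears \<tau> s r (greedy ls) e u \<longleftrightarrow> precedes ls (f, Sample) (e, Reward)"
      unfolding clears_def prec[OF f(1)] price[OF f] using uniq f by blast
    also have "\<dots> \<longleftrightarrow> (\<forall>f\<in>greedy ls. u \<in> f \<longrightarrow> precedes ls (f, Sample) (e, Reward))"
      using uniq f by blast
    finally show ?thesis .
  next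
    case False
    then show ?thesis using r unfolding clears_def price_def by auto
  qed
  then have "(\<forall>u\<in>e. clears \<tau> s r (greedy ls) e u) \<longleftrightarrow>
     (\<forall>f\<in>greedy ls. e \<inter> f \<noteq> {} \<longrightarrow> precedes ls (f, Sample) (e, Reward))"
    by blast
  also have "\<dots> \<longleftrightarrow> e \<in> accepted ls"
    using accepted_iff[of ls e] \<tau>' eR by (simp add: ls_def)
  finally show ?thesis by (simp add: N ls_def)
qed

definition merged_alg ::
  "'v set list \<Rightarrow> ('v set \<times> draw) list \<Rightarrow> ('v set \<Rightarrow> real) \<Rightarrow> ('v set \<Rightarrow> real) \<Rightarrow> 'v set set" where
  "merged_alg \<sigma> \<tau> s r = online_matching (\<lambda>e. e \<in> accepted (draw_order (val s r) \<tau>)) \<sigma>"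

lemma alg_ties_eq_merged:
  assumes "\<tau> \<in> tie_orders E" "set \<sigma> = E" "\<And>e. e \<in> E \<Longrightarrow> 0 \<le> r e"
  shows "alg_ties \<sigma> \<tau> s r = merged_alg \<sigma> \<tau> s r"
  unfolding alg_ties_def merged_alg_def
  using assms(2,3) by (intro online_matching_cong clears_iff_accepted[OF assms(1)]) auto

lemma alg_eq_alg_ties:
  assumes \<tau>: "\<tau> \<in> tie_orders E" and "set \<sigma> = E" and edges: "\<And>e. e \<in> E \<Longrightarrow> card e = 2"
    and no_tie: "\<And>e f. e \<in> E \<Longrightarrow> f \<in> E \<Longrightarrow> r e \<noteq> s f"
  shows "alg \<sigma> \<tau> s r = alg_ties \<sigma> \<tau> s r"
  unfolding alg_def alg_ties_def
proof (rule online_matching_cong)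
  fix e assume "e \<in> set \<sigma>"
  then have e: "e \<in> E" using assms by simp
  let ?N = "sample_matching \<tau> s"
  have N: "?N = greedy (draw_order (val s s) \<tau>)" by (rule sample_matching_eq)
  have sub: "?N \<subseteq> E"
    using greedy_subset \<tau> unfolding N by (fastforce simp: tie_orders_def permutations_of_setD)
  have "clears \<tau> s r ?N e u \<longleftrightarrow> price s ?N u \<le> r e" for u
  proof (cases "u \<in> \<Union>?N")
    case True
    then obtain f where f: "f \<in> ?N" "u \<in> f" by blast
    have "disjoint ?N" unfolding N by (rule disjoint_greedy)
    then have "price s ?N u = s f" using f by (rule price_eq)
    then show ?thesis using no_tie[OF e, of f] f sub by (auto simp: clears_def)
  next
    case False
    then show ?thesis by (auto simp: clears_def)
  qed
  moreover have "finite e" "e \<noteq> {}" using edges[OF e] card_ge_0_finite by force+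
  ultimately show "Max (price s ?N ` e) \<le> r e \<longleftrightarrow> (\<forall>u\<in>e. clears \<tau> s r ?N e u)"
    by (simp add: Max_le_iff)
qed

lemma sum_opt_le_sum_merged_alg:
  fixes x :: "'v set \<times> draw \<Rightarrow> real"
  assumes fin: "finite E" and edges: "\<And>e. e \<in> E \<Longrightarrow> card e = 2"
    and \<tau>: "\<tau> \<in> tie_orders E" and \<sigma>: "set \<sigma> = E"
    and nonneg: "\<And>i. i \<in> E \<times> {Sample, Reward} \<Longrightarrow> 0 \<le> x i"
    and s: "\<And>c e. e \<in> E \<Longrightarrow> s c e = x (flip c (e, Sample))"
    and r: "\<And>c e. e \<in> E \<Longrightarrow> r c e = x (flip c (e, Reward))"
  shows "(\<Sum>c\<in>Pow E. opt E (s c))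
     \<le> 16 * (\<Sum>c\<in>Pow E. weight (r c) (merged_alg \<sigma> (map (flip c) \<tau>) (s c) (r c)))"
proof -
  define L where "L = draw_order x \<tau>"
  define A where "A c = weight (r c) (merged_alg \<sigma> (map (flip c) \<tau>) (s c) (r c))" for c
  define P where "P c = potential (x \<circ> flip c) (map (flip c) L)" for c
  have \<tau>': "distinct \<tau>" "set \<tau> = E \<times> {Sample, Reward}"
    using \<tau> by (auto simp: tie_orders_def permutations_of_setD)
  have L: "distinct L" "set L = E \<times> {Sample, Reward}" "sorted_wrt (\<lambda>i j. x i \<le> x j) L"
    using \<tau>' sorted_draw_order by (auto simp: L_def)
  have "0 \<le> (\<Sum>c\<in>Pow E. P c)"
    unfolding P_def by (rule sum_potential_nonneg) (use fin L nonneg edges in auto)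
  also have "\<dots> \<le> (\<Sum>c\<in>Pow E. 8 * A c - opt E (s c) / 2)"
  proof (rule sum_mono)
    fix c
    let ?ls = "map (flip c) L" and ?y = "x \<circ> flip c"
    have ls: "set ?ls = E \<times> {Sample, Reward}" "sorted_wrt (\<lambda>i j. ?y i \<le> ?y j) ?ls"
      using L by (auto simp: flip_image sorted_wrt_map)
    have val: "val (s c) (r c) i = ?y i" if "i \<in> E \<times> {Sample, Reward}" for i
      using that s r by (auto simp: val_def)
    have y0: "0 \<le> ?y i" if "i \<in> E \<times> {Sample, Reward}" for i
      using that nonneg flip_in_iff[of c i E] by (simp add: flip_in_iff)
    have M: "merged_alg \<sigma> (map (flip c) \<tau>) (s c) (r c) = online_matching (\<lambda>e. e \<in> accepted ?ls) \<sigma>" (is "_ = ?M")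
    proof -
      have "draw_order (val (s c) (r c)) (map (flip c) \<tau>) = ?ls"
        unfolding L_def
      proof (rule draw_order_flip)
        fix i assume "i \<in> set \<tau>"
        then have "flip c i \<in> E \<times> {Sample, Reward}" using \<tau>'(2) flip_in_iff[of c i E] by blast
        from val[OF this] show "val (s c) (r c) (flip c i) = x i" by simp
      qed
      then show ?thesis by (simp add: merged_alg_def)
    qed
    have "P c \<le> 8 * (\<Sum>e\<in>?M. ?y (e, Reward)) - (\<Sum>f\<in>greedy ?ls. ?y (f, Sample))"
      unfolding P_def by (rule potential_le_online[of E]) (use edges ls \<sigma> y0 in auto)
    moreover have "(\<Sum>e\<in>?M. ?y (e, Reward)) = A c"
      unfolding A_def M weight_def
      using online_matching_subset[of "\<lambda>e. e \<in> accepted ?ls" \<sigma>] \<sigma> r by (intro sum.cong) auto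
    moreover have "opt E (s c) \<le> 2 * (\<Sum>f\<in>greedy ?ls. ?y (f, Sample))"
      by (rule opt_le_greedy) (use fin edges ls s y0 in auto)
    ultimately show "P c \<le> 8 * A c - opt E (s c) / 2" by linarith
  qed
  finally show ?thesis
    by (simp add: A_def sum_subtractf flip: sum_distrib_left sum_divide_distrib)
qed

subsection \<open>Measurability and symmetrization\<close>

lemma pred_insort_key_eq:
  fixes k :: "'w \<Rightarrow> 'a \<Rightarrow> real"
  assumes "\<And>i. i \<in> insert x (set ys) \<Longrightarrow> (\<lambda>\<omega>. k \<omega> i) \<in> borel_measurable M"
  shows "Measurable.pred M (\<lambda>\<omega>. insort_key (k \<omega>) x ys = l)"
  using assms
proof (induction ys arbitrary: l)
  case (Cons z ys)
  have [measurable]: "(\<lambda>\<omega>. k \<omega> x) \<in> borel_measurable M" "(\<lambda>\<omega>. k \<omega> z) \<in> borel_measurable M"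
    using Cons.prems by auto
  have [measurable]: "Measurable.pred M (\<lambda>\<omega>. insort_key (k \<omega>) x ys = tl l)"
    using Cons by auto
  have "insort_key (k \<omega>) x (z # ys) = l \<longleftrightarrow> (k \<omega> x \<le> k \<omega> z \<and> x # z # ys = l) \<or>
     (k \<omega> z < k \<omega> x \<and> l \<noteq> [] \<and> hd l = z \<and> insort_key (k \<omega>) x ys = tl l)" for \<omega>
    by (cases l) auto
  then show ?case by simp
qed simp

lemma pred_sort_key_eq:
  fixes k :: "'w \<Rightarrow> 'a \<Rightarrow> real"
  assumes "\<And>i. i \<in> set xs \<Longrightarrow> (\<lambda>\<omega>. k \<omega> i) \<in> borel_measurable M"
  shows "Measurable.pred M (\<lambda>\<omega>. sort_key (k \<omega>) xs = l)"
  using assms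
proof (induction xs arbitrary: l)
  case (Cons x xs)
  let ?P = "permutations_of_multiset (mset xs)"
  have perm: "sort_key (k \<omega>) xs \<in> ?P" for \<omega>
    by (simp add: permutations_of_multiset_def)
  have "sort_key (k \<omega>) (x # xs) = l \<longleftrightarrow>
      (\<exists>l'\<in>?P. sort_key (k \<omega>) xs = l' \<and> insort_key (k \<omega>) x l' = l)" for \<omega>
    using perm[of \<omega>] by auto
  moreover have "Measurable.pred M
      (\<lambda>\<omega>. \<exists>l'\<in>?P. sort_key (k \<omega>) xs = l' \<and> insort_key (k \<omega>) x l' = l)"
  proof (rule pred_intros_finite(4))
    fix l' assume "l' \<in> ?P"
    then have "set l' = set xs" by (metis permutations_of_multisetD set_mset_mset)
    then show "Measurable.pred M (\<lambda>\<omega>. sort_key (k \<omega>) xs = l' \<and> insort_key (k \<omega>) x l' = l)"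
      using Cons.prems by (intro pred_intros_logic Cons.IH pred_insort_key_eq) auto
  qed simp
  ultimately show ?case by presburger
qed simp

lemma pred_sort_key:
  fixes k :: "'w \<Rightarrow> 'a \<Rightarrow> real"
  assumes "\<And>i. i \<in> set xs \<Longrightarrow> (\<lambda>\<omega>. k \<omega> i) \<in> borel_measurable M"
  shows "Measurable.pred M (\<lambda>\<omega>. R (sort_key (k \<omega>) xs))"
proof -
  let ?P = "{l \<in> permutations_of_multiset (mset xs). R l}"
  have "sort_key (k \<omega>) xs \<in> permutations_of_multiset (mset xs)" for \<omega>
    by (simp add: permutations_of_multiset_def)
  then have "R (sort_key (k \<omega>) xs) \<longleftrightarrow> (\<exists>l\<in>?P. sort_key (k \<omega>) xs = l)" for \<omega>
    by auto
  moreover have "Measurable.pred M (\<lambda>\<omega>. \<exists>l\<in>?P. sort_key (k \<omega>) xs = l)"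
    using assms by (intro pred_intros_finite(4) pred_sort_key_eq) auto
  ultimately show ?thesis by presburger
qed

lemma measurable_weight_merged_alg:
  assumes D: "\<And>e. e \<in> E \<Longrightarrow> sets (D e) = sets borel" and \<tau>: "\<tau> \<in> tie_orders E" and \<sigma>: "set \<sigma> = E"
  shows "(\<lambda>(s, r). weight r (merged_alg \<sigma> \<tau> s r)) \<in> borel_measurable (PiM E D \<Otimes>\<^sub>M PiM E D)"
proof -
  let ?M = "PiM E D \<Otimes>\<^sub>M PiM E D"
  have [measurable]: "(\<lambda>\<omega>. fst \<omega> e) \<in> borel_measurable ?M" "(\<lambda>\<omega>. snd \<omega> e) \<in> borel_measurable ?M"
    if "e \<in> E" for e
    using that measurable_component_singleton[of e E D] D[OF that]
    by (auto intro!: measurable_compose[OF measurable_fst] measurable_compose[OF measurable_snd]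
        simp: measurable_cong_sets[OF refl D[OF that]])
  have \<tau>': "set \<tau> = E \<times> {Sample, Reward}"
    using \<tau> by (auto simp: tie_orders_def permutations_of_setD)
  have k: "(\<lambda>\<omega>. - val (fst \<omega>) (snd \<omega>) i) \<in> borel_measurable ?M" if "i \<in> set \<tau>" for i
    using that unfolding \<tau>' by (auto intro!: borel_measurable_uminus)
  have pred: "Measurable.pred ?M (\<lambda>\<omega>. e \<in> merged_alg \<sigma> \<tau> (fst \<omega>) (snd \<omega>))" for e
    unfolding merged_alg_def draw_order_def
    by (rule pred_sort_key[OF k, where R = "\<lambda>l. e \<in> online_matching (\<lambda>e. e \<in> accepted (rev l)) \<sigma>"])
  have sub: "merged_alg \<sigma> \<tau> s r \<subseteq> E" for s r
    unfolding merged_alg_def using online_matching_subset \<sigma> by fastforce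
  have "finite E" using \<sigma> by auto
  then have "weight r (merged_alg \<sigma> \<tau> s r) = (\<Sum>e\<in>E. if e \<in> merged_alg \<sigma> \<tau> s r then r e else 0)" for s r
    unfolding weight_def using sub[of s r] by (simp add: sum.If_cases Int_absorb1 flip: Int_def)
  moreover have "(\<lambda>\<omega>. \<Sum>e\<in>E. if e \<in> merged_alg \<sigma> \<tau> (fst \<omega>) (snd \<omega>) then snd \<omega> e else 0) \<in> borel_measurable ?M"
    using pred by (intro borel_measurable_sum measurable_If) auto
  ultimately show ?thesis by (simp add: case_prod_beta')
qed

lemma measurable_opt:
  assumes "\<And>e. e \<in> E \<Longrightarrow> sets (D e) = sets borel" and "finite E"
  shows "opt E \<in> borel_measurable (PiM E D)"
proof -
  have "(\<lambda>r. r e) \<in> borel_measurable (PiM E D)" if "e \<in> E" for e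
    using measurable_component_singleton[OF that, of D]
    by (simp add: measurable_cong_sets[OF refl assms(1)[OF that]])
  then have "(\<lambda>r. weight r N) \<in> borel_measurable (PiM E D)" if "matching E N" for N
    using that unfolding weight_def matching_def by (intro borel_measurable_sum) auto
  then have "(\<lambda>r. Max ((\<lambda>N. weight r N) ` {N. matching E N})) \<in> borel_measurable (PiM E D)"
    using finite_matchings[OF assms(2)] by (intro borel_measurable_Max) auto
  then show ?thesis by (simp add: opt_def [abs_def])
qed

definition draws :: "'v set set \<Rightarrow> ('v set \<Rightarrow> real measure) \<Rightarrow> ('v set \<times> draw \<Rightarrow> real) measure" where
  "draws E D = PiM (E \<times> {Sample, Reward}) (\<lambda>i. D (fst i))"

definition split_draws ::
  "'v set set \<Rightarrow> ('v set \<times> draw \<Rightarrow> real) \<Rightarrow> ('v set \<Rightarrow> real) \<times> ('v set \<Rightarrow> real)" where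
  "split_draws E \<omega> = (\<lambda>e\<in>E. \<omega> (e, Sample), \<lambda>e\<in>E. \<omega> (e, Reward))"

definition flip_draws ::
  "'v set set \<Rightarrow> 'v set set \<Rightarrow> ('v set \<times> draw \<Rightarrow> real) \<Rightarrow> ('v set \<times> draw \<Rightarrow> real)" where
  "flip_draws E c \<omega> = (\<lambda>i\<in>E \<times> {Sample, Reward}. \<omega> (flip c i))"

lemma measurable_split_draws: "split_draws E \<in> draws E D \<rightarrow>\<^sub>M PiM E D \<Otimes>\<^sub>M PiM E D"
proof -
  have "(\<lambda>\<omega>. \<omega> (e, d)) \<in> PiM (E \<times> {Sample, Reward}) (\<lambda>i. D (fst i)) \<rightarrow>\<^sub>M D e" if "e \<in> E" for e d
    using that measurable_component_singleton[of "(e, d)" "E \<times> {Sample, Reward}" "\<lambda>i. D (fst i)"]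
    by (cases d) auto
  then show ?thesis
    unfolding split_draws_def [abs_def] draws_def by (intro measurable_Pair measurable_restrict) auto
qed

lemma measurable_flip_draws: "flip_draws E c \<in> draws E D \<rightarrow>\<^sub>M draws E D"
  unfolding flip_draws_def [abs_def] draws_def
proof (rule measurable_restrict)
  fix i assume "i \<in> E \<times> {Sample, Reward}"
  then have "flip c i \<in> E \<times> {Sample, Reward}" by (simp add: flip_in_iff)
  from measurable_component_singleton[OF this, of "\<lambda>i. D (fst i)"]
  show "(\<lambda>\<omega>. \<omega> (flip c i)) \<in> PiM (E \<times> {Sample, Reward}) (\<lambda>i. D (fst i)) \<rightarrow>\<^sub>M D (fst i)" by simp
qed

lemma distr_flip_draws:
  assumes "\<And>e. e \<in> E \<Longrightarrow> prob_space (D e)"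
  shows "distr (draws E D) (draws E D) (flip_draws E c) = draws E D"
proof -
  let ?I = "E \<times> {Sample, Reward}"
  have "distr (PiM ?I (\<lambda>i. D (fst i))) (PiM ?I (\<lambda>i. D (fst (flip c i)))) (\<lambda>\<omega>. \<lambda>n\<in>?I. \<omega> (flip c n))
      = PiM ?I (\<lambda>i. D (fst (flip c i)))"
    by (rule distr_PiM_reindex) (use assms flip_in_iff[of c] in \<open>auto simp: inj_flip\<close>)
  then show ?thesis by (simp add: draws_def flip_draws_def [abs_def])
qed

lemma distr_split_draws:
  assumes D: "\<And>e. e \<in> E \<Longrightarrow> prob_space (D e)" and fin: "finite E"
  shows "distr (draws E D) (PiM E D \<Otimes>\<^sub>M PiM E D) (split_draws E) = PiM E D \<Otimes>\<^sub>M PiM E D"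
proof -
  define M where "M i = (if fst i \<in> E then D (fst i) else return borel (0::real))" for i :: "'a set \<times> draw"
  have M: "prob_space (M i)" for i
    by (simp add: M_def D prob_space_return)
  interpret product_prob_space M "UNIV"
    by (intro product_prob_spaceI) (use M in auto)
  let ?S = "E \<times> {Sample}" and ?R = "E \<times> {Reward}" and ?P = "PiM E D"
  have I: "E \<times> {Sample, Reward} = ?S \<union> ?R" by auto
  have draws: "draws E D = PiM (?S \<union> ?R) M"
    unfolding draws_def I by (intro PiM_cong) (auto simp: M_def)
  have reindex: "distr (PiM (E \<times> {d}) M) ?P (\<lambda>\<omega>. \<lambda>e\<in>E. \<omega> (e, d)) = ?P" for d
  proof -
    have "distr (PiM (E \<times> {d}) M) (PiM E (\<lambda>e. M (e, d))) (\<lambda>\<omega>. \<lambda>e\<in>E. \<omega> (e, d)) = PiM E (\<lambda>e. M (e, d))"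
      by (rule distr_PiM_reindex) (auto simp: M inj_on_def)
    moreover have "PiM E (\<lambda>e. M (e, d)) = ?P"
      by (intro PiM_cong) (auto simp: M_def)
    ultimately show ?thesis by simp
  qed
  have meas: "(\<lambda>\<omega>. \<lambda>e\<in>E. \<omega> (e, d)) \<in> PiM (E \<times> {d}) M \<rightarrow>\<^sub>M ?P" for d
  proof (rule measurable_restrict)
    fix e assume e: "e \<in> E"
    then have "(\<lambda>\<omega>. \<omega> (e, d)) \<in> PiM (E \<times> {d}) M \<rightarrow>\<^sub>M M (e, d)"
      by (intro measurable_component_singleton) auto
    then show "(\<lambda>\<omega>. \<omega> (e, d)) \<in> PiM (E \<times> {d}) M \<rightarrow>\<^sub>M D e"
      using e by (simp add: M_def)
  qed
  have "prob_space ?P" using D by (rule prob_space_PiM)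
  then have sf: "sigma_finite_measure ?P" by (rule prob_space_imp_sigma_finite)
  have merge: "split_draws E (merge ?S ?R \<omega>) =
     (case \<omega> of (a, b) \<Rightarrow> (\<lambda>e\<in>E. a (e, Sample), \<lambda>e\<in>E. b (e, Reward)))" for \<omega>
    by (cases \<omega>) (auto simp: split_draws_def merge_def fun_eq_iff)
  have "draws E D = distr (PiM ?S M \<Otimes>\<^sub>M PiM ?R M) (draws E D) (merge ?S ?R)"
    unfolding draws by (rule distr_merge[symmetric]) (use fin in auto)
  then have "distr (draws E D) (?P \<Otimes>\<^sub>M ?P) (split_draws E) =
      distr (distr (PiM ?S M \<Otimes>\<^sub>M PiM ?R M) (draws E D) (merge ?S ?R)) (?P \<Otimes>\<^sub>M ?P) (split_draws E)"
    by simp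
  also have "\<dots> = distr (PiM ?S M \<Otimes>\<^sub>M PiM ?R M) (?P \<Otimes>\<^sub>M ?P) (split_draws E \<circ> merge ?S ?R)"
    by (rule distr_distr[OF measurable_split_draws]) (simp add: draws)
  also have "split_draws E \<circ> merge ?S ?R =
      (\<lambda>(a, b). (\<lambda>e\<in>E. a (e, Sample), \<lambda>e\<in>E. b (e, Reward)))"
    using merge by (auto simp: fun_eq_iff)
  also have "distr (PiM ?S M \<Otimes>\<^sub>M PiM ?R M) (?P \<Otimes>\<^sub>M ?P) \<dots> =
     distr (PiM ?S M) ?P (\<lambda>a. \<lambda>e\<in>E. a (e, Sample)) \<Otimes>\<^sub>M distr (PiM ?R M) ?P (\<lambda>b. \<lambda>e\<in>E. b (e, Reward))"
    by (rule pair_measure_distr[symmetric]) (use meas sf reindex in simp_all)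
  finally show ?thesis by (simp add: reindex)
qed

lemma tie_orders_flip: "bij_betw (map (flip c)) (tie_orders E) (tie_orders E)"
proof (rule bij_betwI[where g = "map (flip c)"])
  show "map (flip c) \<in> tie_orders E \<rightarrow> tie_orders E"
    "map (flip c) \<in> tie_orders E \<rightarrow> tie_orders E"
    by (auto simp: tie_orders_def permutations_of_set_def distinct_map inj_flip flip_image)
qed (simp_all add: comp_def)

lemma tie_orders_finite_nonempty:
  "finite E \<Longrightarrow> finite (tie_orders E)" "finite E \<Longrightarrow> tie_orders E \<noteq> {}"
  by (auto simp: tie_orders_def permutations_of_set_empty_iff)

lemma nn_integral_outcomes:
  assumes D: "\<And>e. e \<in> E \<Longrightarrow> prob_space (D e)" and fin: "finite E"
    and f: "\<And>\<tau>. \<tau> \<in> tie_orders E \<Longrightarrow> (\<lambda>y. f (\<tau>, y)) \<in> borel_measurable (PiM E D \<Otimes>\<^sub>M PiM E D)"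
  shows "(\<integral>\<^sup>+ x. f x \<partial>outcomes E D) =
     ennreal (1 / card (tie_orders E)) * (\<Sum>\<tau>\<in>tie_orders E. \<integral>\<^sup>+ \<omega>. f (\<tau>, split_draws E \<omega>) \<partial>draws E D)"
proof -
  let ?P = "PiM E D \<Otimes>\<^sub>M PiM E D" and ?U = "uniform_count_measure (tie_orders E)"
  have "prob_space ?P" using D by (intro prob_space_pair prob_space_PiM)
  then interpret sigma_finite_measure ?P by (rule prob_space_imp_sigma_finite)
  have "f \<in> borel_measurable (count_space (tie_orders E) \<Otimes>\<^sub>M ?P)"
    using f fin by (intro measurable_pair_measure_countable1) (auto intro: countable_finite tie_orders_finite_nonempty)
  then have "f \<in> borel_measurable (?U \<Otimes>\<^sub>M ?P)"
    by (simp cong: measurable_cong_sets sets_pair_measure_cong add: sets_uniform_count_measure_count_space)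
  then have "(\<integral>\<^sup>+ x. f x \<partial>outcomes E D) = (\<integral>\<^sup>+ \<tau>. \<integral>\<^sup>+ y. f (\<tau>, y) \<partial>?P \<partial>?U)"
    by (simp add: outcomes_def nn_integral_fst)
  also have "\<dots> = (\<Sum>\<tau>\<in>tie_orders E. ennreal (1 / card (tie_orders E)) * (\<integral>\<^sup>+ y. f (\<tau>, y) \<partial>?P))"
    unfolding uniform_count_measure_def using fin
    by (subst nn_integral_point_measure_finite) (auto simp: tie_orders_finite_nonempty mult.commute)
  also have "\<dots> = ennreal (1 / card (tie_orders E)) * (\<Sum>\<tau>\<in>tie_orders E. \<integral>\<^sup>+ y. f (\<tau>, y) \<partial>?P)"
    by (simp add: sum_distrib_left)
  also have "(\<Sum>\<tau>\<in>tie_orders E. \<integral>\<^sup>+ y. f (\<tau>, y) \<partial>?P) =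
      (\<Sum>\<tau>\<in>tie_orders E. \<integral>\<^sup>+ \<omega>. f (\<tau>, split_draws E \<omega>) \<partial>draws E D)"
  proof (rule sum.cong)
    fix \<tau> assume "\<tau> \<in> tie_orders E"
    have "(\<integral>\<^sup>+ y. f (\<tau>, y) \<partial>?P) = (\<integral>\<^sup>+ y. f (\<tau>, y) \<partial>distr (draws E D) ?P (split_draws E))"
      by (simp add: distr_split_draws D fin)
    also have "\<dots> = (\<integral>\<^sup>+ \<omega>. f (\<tau>, split_draws E \<omega>) \<partial>draws E D)"
      by (rule nn_integral_distr[OF measurable_split_draws]) (use f \<open>\<tau> \<in> tie_orders E\<close> in simp)
    finally show "(\<integral>\<^sup>+ y. f (\<tau>, y) \<partial>?P) = (\<integral>\<^sup>+ \<omega>. f (\<tau>, split_draws E \<omega>) \<partial>draws E D)" .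
  qed simp
  finally show ?thesis .
qed

lemma sum_nn_integral_flip:
  assumes D: "\<And>e. e \<in> E \<Longrightarrow> prob_space (D e)"
    and f: "\<And>\<tau>. \<tau> \<in> tie_orders E \<Longrightarrow> f \<tau> \<in> borel_measurable (PiM E D \<Otimes>\<^sub>M PiM E D)"
  shows "(\<Sum>\<tau>\<in>tie_orders E. \<integral>\<^sup>+ \<omega>. f \<tau> (split_draws E \<omega>) \<partial>draws E D) =
     (\<Sum>\<tau>\<in>tie_orders E. \<integral>\<^sup>+ \<omega>. f (map (flip c) \<tau>) (split_draws E (flip_draws E c \<omega>)) \<partial>draws E D)"
proof -
  let ?g = "\<lambda>\<tau>. \<integral>\<^sup>+ \<omega>. f \<tau> (split_draws E \<omega>) \<partial>draws E D"
  have "(\<Sum>\<tau>\<in>tie_orders E. ?g \<tau>) = (\<Sum>\<tau>\<in>tie_orders E. ?g (map (flip c) \<tau>))"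
    using tie_orders_flip by (rule sum.reindex_bij_betw[symmetric])
  also have "\<dots> = (\<Sum>\<tau>\<in>tie_orders E. \<integral>\<^sup>+ \<omega>. f (map (flip c) \<tau>) (split_draws E (flip_draws E c \<omega>)) \<partial>draws E D)"
  proof (rule sum.cong)
    fix \<tau> assume "\<tau> \<in> tie_orders E"
    then have "map (flip c) \<tau> \<in> tie_orders E" using tie_orders_flip bij_betwE by blast
    then have "(\<lambda>\<omega>. f (map (flip c) \<tau>) (split_draws E \<omega>)) \<in> borel_measurable (draws E D)"
      using f measurable_compose[OF measurable_split_draws] by blast
    then have "(\<integral>\<^sup>+ \<omega>. f (map (flip c) \<tau>) (split_draws E \<omega>) \<partial>distr (draws E D) (draws E D) (flip_draws E c))
       = (\<integral>\<^sup>+ \<omega>. f (map (flip c) \<tau>) (split_draws E (flip_draws E c \<omega>)) \<partial>draws E D)"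
      by (intro nn_integral_distr[OF measurable_flip_draws]) simp
    then show "?g (map (flip c) \<tau>) = (\<integral>\<^sup>+ \<omega>. f (map (flip c) \<tau>) (split_draws E (flip_draws E c \<omega>)) \<partial>draws E D)"
      by (simp add: distr_flip_draws D)
  qed simp
  finally show ?thesis .
qed

lemma opt_nonneg:
  assumes "finite E" shows "0 \<le> opt E r"
proof -
  have "matching E {}" by (simp add: matching_def)
  then have "weight r {} \<le> opt E r"
    unfolding opt_def using finite_matchings[OF assms] by (intro Max_ge) auto
  then show ?thesis by (simp add: weight_def)
qed

lemma nn_integral_opt_le_merged_alg:
  assumes fin: "finite E" and edges: "\<And>e. e \<in> E \<Longrightarrow> card e = 2" and \<sigma>: "set \<sigma> = E"
    and D: "\<And>e. e \<in> E \<Longrightarrow> prob_space (D e)" "\<And>e. e \<in> E \<Longrightarrow> sets (D e) = sets borel"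
    and nonneg: "\<And>e. e \<in> E \<Longrightarrow> AE x in D e. 0 \<le> x"
  shows "(\<integral>\<^sup>+ (\<tau>, s, r). ennreal (opt E r) \<partial>outcomes E D)
    \<le> 16 * (\<integral>\<^sup>+ (\<tau>, s, r). ennreal (weight r (merged_alg \<sigma> \<tau> s r)) \<partial>outcomes E D)"
proof -
  let ?P = "PiM E D \<Otimes>\<^sub>M PiM E D" and ?I = "E \<times> {Sample, Reward}" and ?T = "tie_orders E"
  define A where "A \<tau> y = ennreal (weight (snd y) (merged_alg \<sigma> \<tau> (fst y) (snd y)))" for \<tau> y
  define R where "R (\<tau> :: ('a set \<times> draw) list) y = ennreal (opt E (snd y))"
    for \<tau> and y :: "('a set \<Rightarrow> real) \<times> ('a set \<Rightarrow> real)"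
  define S where "S (\<tau> :: ('a set \<times> draw) list) y = ennreal (opt E (fst y))"
    for \<tau> and y :: "('a set \<Rightarrow> real) \<times> ('a set \<Rightarrow> real)"
  define J where "J f = (\<Sum>\<tau>\<in>?T. \<integral>\<^sup>+ \<omega>. f \<tau> (split_draws E \<omega>) \<partial>draws E D)"
    for f :: "('a set \<times> draw) list \<Rightarrow> _ \<Rightarrow> ennreal"
  have A: "A \<tau> \<in> borel_measurable ?P" if "\<tau> \<in> ?T" for \<tau>
    using measurable_weight_merged_alg[OF D(2) that \<sigma>]
    unfolding A_def [abs_def] by (simp add: case_prod_beta' measurable_compose[OF _ measurable_ennreal])
  have [measurable]: "opt E \<in> borel_measurable (PiM E D)" using D(2) fin by (rule measurable_opt)
  have R: "R \<tau> \<in> borel_measurable ?P" for \<tau>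
    unfolding R_def [abs_def] by measurable
  have S: "S \<tau> \<in> borel_measurable ?P" for \<tau>
    unfolding S_def [abs_def] by measurable
  have flip: "J f = (\<Sum>\<tau>\<in>?T. \<integral>\<^sup>+ \<omega>. f (map (flip c) \<tau>) (split_draws E (flip_draws E c \<omega>)) \<partial>draws E D)"
    if "\<And>\<tau>. \<tau> \<in> ?T \<Longrightarrow> f \<tau> \<in> borel_measurable ?P" for f c
    unfolding J_def using D(1) that by (rule sum_nn_integral_flip)
  have sum_flip: "of_nat (card (Pow E)) * J f = (\<Sum>\<tau>\<in>?T. \<integral>\<^sup>+ \<omega>.
      (\<Sum>c\<in>Pow E. f (map (flip c) \<tau>) (split_draws E (flip_draws E c \<omega>))) \<partial>draws E D)"
    if f: "\<And>\<tau>. \<tau> \<in> ?T \<Longrightarrow> f \<tau> \<in> borel_measurable ?P" for f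
  proof -
    have "of_nat (card (Pow E)) * J f = (\<Sum>c\<in>Pow E. J f)" by simp
    also have "\<dots> = (\<Sum>c\<in>Pow E. \<Sum>\<tau>\<in>?T. \<integral>\<^sup>+ \<omega>.
        f (map (flip c) \<tau>) (split_draws E (flip_draws E c \<omega>)) \<partial>draws E D)"
      by (intro sum.cong refl flip f)
    also have "\<dots> = (\<Sum>\<tau>\<in>?T. \<Sum>c\<in>Pow E. \<integral>\<^sup>+ \<omega>.
        f (map (flip c) \<tau>) (split_draws E (flip_draws E c \<omega>)) \<partial>draws E D)"
      by (rule sum.swap)
    also have "\<dots> = (\<Sum>\<tau>\<in>?T. \<integral>\<^sup>+ \<omega>.
      (\<Sum>c\<in>Pow E. f (map (flip c) \<tau>) (split_draws E (flip_draws E c \<omega>))) \<partial>draws E D)"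
    proof (intro sum.cong refl nn_integral_sum[symmetric])
      fix \<tau> c assume "\<tau> \<in> ?T"
      then have "map (flip c) \<tau> \<in> ?T" using tie_orders_flip bij_betwE by blast
      then show "(\<lambda>\<omega>. f (map (flip c) \<tau>) (split_draws E (flip_draws E c \<omega>))) \<in> borel_measurable (draws E D)"
        using f measurable_compose[OF measurable_flip_draws measurable_compose[OF measurable_split_draws]] by blast
    qed
    finally show ?thesis .
  qed
  have "AE \<omega> in draws E D. 0 \<le> \<omega> i" if "i \<in> ?I" for i
    unfolding draws_def by (rule AE_PiM_component) (use D nonneg that in auto)
  then have "AE \<omega> in draws E D. \<forall>i\<in>?I. 0 \<le> \<omega> i"
    using fin by (simp add: AE_finite_all)
  then have le: "AE \<omega> in draws E D. (\<Sum>c\<in>Pow E. S (map (flip c) \<tau>) (split_draws E (flip_draws E c \<omega>)))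
     \<le> 16 * (\<Sum>c\<in>Pow E. A (map (flip c) \<tau>) (split_draws E (flip_draws E c \<omega>)))"
    if \<tau>: "\<tau> \<in> ?T" for \<tau>
  proof eventually_elim
    case (elim \<omega>)
    let ?y = "\<lambda>c. split_draws E (flip_draws E c \<omega>)"
    have *: "fst (?y c) e = \<omega> (flip c (e, Sample))" "snd (?y c) e = \<omega> (flip c (e, Reward))" if "e \<in> E" for c e
      using that by (auto simp: split_draws_def flip_draws_def)
    have "(\<Sum>c\<in>Pow E. opt E (fst (?y c)))
      \<le> 16 * (\<Sum>c\<in>Pow E. weight (snd (?y c)) (merged_alg \<sigma> (map (flip c) \<tau>) (fst (?y c)) (snd (?y c))))"
      by (rule sum_opt_le_sum_merged_alg[OF fin edges \<tau> \<sigma>]) (use elim * in auto)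
    moreover have "0 \<le> weight (snd (?y c)) (merged_alg \<sigma> (map (flip c) \<tau>) (fst (?y c)) (snd (?y c)))" for c
      unfolding weight_def
    proof (rule sum_nonneg)
      fix e assume "e \<in> merged_alg \<sigma> (map (flip c) \<tau>) (fst (?y c)) (snd (?y c))"
      then have e: "e \<in> E" using online_matching_subset \<sigma> unfolding merged_alg_def by fastforce
      then have "flip c (e, Reward) \<in> ?I" by (simp add: flip_in_iff)
      then show "0 \<le> snd (?y c) e" using elim * e by metis
    qed
    ultimately show ?case
      unfolding A_def S_def
      by (simp add: opt_nonneg[OF fin] sum_nonneg ennreal_mult' [symmetric] flip: ennreal_numeral)
  qed
  have "of_nat (card (Pow E)) * J S \<le> (\<Sum>\<tau>\<in>?T. \<integral>\<^sup>+ \<omega>.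
      16 * (\<Sum>c\<in>Pow E. A (map (flip c) \<tau>) (split_draws E (flip_draws E c \<omega>))) \<partial>draws E D)"
    unfolding sum_flip[OF S] using le by (intro sum_mono nn_integral_mono_AE)
  also have "\<dots> = (\<Sum>\<tau>\<in>?T. 16 * (\<integral>\<^sup>+ \<omega>.
      (\<Sum>c\<in>Pow E. A (map (flip c) \<tau>) (split_draws E (flip_draws E c \<omega>))) \<partial>draws E D))"
  proof (intro sum.cong refl nn_integral_cmult borel_measurable_sum)
    fix \<tau> c assume "\<tau> \<in> ?T"
    then have "map (flip c) \<tau> \<in> ?T" using tie_orders_flip bij_betwE by blast
    then show "(\<lambda>\<omega>. A (map (flip c) \<tau>) (split_draws E (flip_draws E c \<omega>))) \<in> borel_measurable (draws E D)"
      using A measurable_compose[OF measurable_flip_draws measurable_compose[OF measurable_split_draws]] by blast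
  qed
  also have "\<dots> = of_nat (card (Pow E)) * (16 * J A)"
    unfolding sum_distrib_left[symmetric] mult.left_commute[of _ 16]
    by (rule arg_cong[OF sum_flip[of A, symmetric]]) (rule A)
  finally have "J S \<le> 16 * J A"
    using fin by (subst (asm) ennreal_mult_le_mult_iff) (auto simp: card_eq_0_iff)
  moreover have "J R = J S"
  proof -
    have "R \<tau> (split_draws E (flip_draws E UNIV \<omega>)) = S \<tau>' (split_draws E \<omega>)" for \<tau> \<tau>' \<omega>
    proof -
      have "snd (split_draws E (flip_draws E UNIV \<omega>)) = fst (split_draws E \<omega>)"
        by (auto simp: split_draws_def flip_draws_def flip_def fun_eq_iff)
      then show ?thesis by (simp add: R_def S_def)
    qed
    then show ?thesis unfolding flip[of R UNIV, OF R] unfolding J_def by (intro sum.cong nn_integral_cong) auto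
  qed
  ultimately have JR: "J R \<le> 16 * J A" by simp
  let ?k = "ennreal (1 / card ?T)"
  have "(\<integral>\<^sup>+ (\<tau>, s, r). ennreal (opt E r) \<partial>outcomes E D) = ?k * J R"
    unfolding J_def by (subst nn_integral_outcomes[OF D(1) fin])
      (use R in \<open>auto simp: R_def case_prod_beta'\<close>)
  also have "\<dots> \<le> ?k * (16 * J A)" using JR by (rule mult_left_mono) simp
  also have "\<dots> = 16 * (?k * J A)" by (simp add: mult.left_commute)
  also have "?k * J A = (\<integral>\<^sup>+ (\<tau>, s, r). ennreal (weight r (merged_alg \<sigma> \<tau> s r)) \<partial>outcomes E D)"
    unfolding J_def by (subst nn_integral_outcomes[OF D(1) fin])
      (use A[unfolded A_def [abs_def]] in \<open>auto simp: A_def case_prod_beta'\<close>)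
  finally show ?thesis .
qed

lemma AE_outcomes:
  assumes D: "\<And>e. e \<in> E \<Longrightarrow> prob_space (D e)" "\<And>e. e \<in> E \<Longrightarrow> sets (D e) = sets borel"
    and fin: "finite E"
    and Q: "Measurable.pred (PiM E D \<Otimes>\<^sub>M PiM E D) (\<lambda>y. Q (fst y) (snd y))"
    and AE: "\<And>s. AE r in PiM E D. Q s r"
  shows "AE x in outcomes E D. Q (fst (snd x)) (snd (snd x))"
proof -
  let ?U = "uniform_count_measure (tie_orders E)" and ?P = "PiM E D"
  have P: "prob_space ?P" using D by (intro prob_space_PiM)
  interpret P: prob_space ?P by fact
  interpret PP: pair_sigma_finite ?P ?P ..
  interpret PP': prob_space "?P \<Otimes>\<^sub>M ?P" using P by (intro prob_space_pair)
  interpret U: prob_space ?U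
    using tie_orders_finite_nonempty[OF fin] by (intro prob_space_uniform_count_measure)
  interpret UP: pair_sigma_finite ?U "?P \<Otimes>\<^sub>M ?P" ..
  have "AE y in ?P \<Otimes>\<^sub>M ?P. Q (fst y) (snd y)"
    by (rule PP.AE_pair_measure) (use Q AE in \<open>simp_all add: pred_def\<close>)
  then show ?thesis unfolding outcomes_def
    by (intro UP.AE_pair_measure)
      (use measurable_compose[OF measurable_snd Q] in \<open>simp_all add: pred_def\<close>)
qed

lemma AE_outcomes_nonneg:
  assumes D: "\<And>e. e \<in> E \<Longrightarrow> prob_space (D e)" "\<And>e. e \<in> E \<Longrightarrow> sets (D e) = sets borel"
    and fin: "finite E" and nonneg: "\<And>e. e \<in> E \<Longrightarrow> AE x in D e. 0 \<le> x"
  shows "AE x in outcomes E D. \<forall>e\<in>E. 0 \<le> snd (snd x) e"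
proof -
  have "AE x in outcomes E D. 0 \<le> snd (snd x) e" if e: "e \<in> E" for e
  proof (rule AE_outcomes[OF D fin, where Q = "\<lambda>s r. 0 \<le> r e"])
    have "(\<lambda>r. r e) \<in> borel_measurable (PiM E D)"
      using measurable_component_singleton[OF e, of D] by (simp add: measurable_cong_sets[OF refl D(2)[OF e]])
    from measurable_compose[OF measurable_snd this]
    have [measurable]: "(\<lambda>y. snd y e) \<in> borel_measurable (PiM E D \<Otimes>\<^sub>M PiM E D)" .
    show "Measurable.pred (PiM E D \<Otimes>\<^sub>M PiM E D) (\<lambda>y. 0 \<le> snd y e)" by measurable
    show "AE r in PiM E D. 0 \<le> r e"
      by (rule AE_PiM_component) (use D nonneg e in auto)
  qed
  then show ?thesis using fin by (simp add: AE_finite_all)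
qed

lemma AE_outcomes_no_tie:
  assumes D: "\<And>e. e \<in> E \<Longrightarrow> prob_space (D e)" "\<And>e. e \<in> E \<Longrightarrow> sets (D e) = sets borel"
    and fin: "finite E" and atomless: "\<And>e x. e \<in> E \<Longrightarrow> measure (D e) {x} = 0"
  shows "AE x in outcomes E D. \<forall>e\<in>E. \<forall>f\<in>E. snd (snd x) e \<noteq> fst (snd x) f"
proof -
  have "AE x in outcomes E D. snd (snd x) e \<noteq> fst (snd x) f" if e: "e \<in> E" and f: "f \<in> E" for e f
  proof (rule AE_outcomes[OF D fin, where Q = "\<lambda>s r. r e \<noteq> s f"])
    have "(\<lambda>r. r e) \<in> borel_measurable (PiM E D)"
      using measurable_component_singleton[OF e, of D] by (simp add: measurable_cong_sets[OF refl D(2)[OF e]])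
    from measurable_compose[OF measurable_snd this]
    have [measurable]: "(\<lambda>y. snd y e) \<in> borel_measurable (PiM E D \<Otimes>\<^sub>M PiM E D)" .
    have "(\<lambda>r. r f) \<in> borel_measurable (PiM E D)"
      using measurable_component_singleton[OF f, of D] by (simp add: measurable_cong_sets[OF refl D(2)[OF f]])
    from measurable_compose[OF measurable_fst this]
    have [measurable]: "(\<lambda>y. fst y f) \<in> borel_measurable (PiM E D \<Otimes>\<^sub>M PiM E D)" .
    show "Measurable.pred (PiM E D \<Otimes>\<^sub>M PiM E D) (\<lambda>y. snd y e \<noteq> fst y f)" by measurable
    fix s :: "'a set \<Rightarrow> real"
    interpret prob_space "D e" using D e by simp
    have "{s f} \<in> null_sets (D e)"
      using atomless[OF e] D(2)[OF e] by (simp add: null_sets_def emeasure_eq_measure)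
    then have "AE x in D e. x \<noteq> s f" by (rule AE_I') auto
    then show "AE r in PiM E D. r e \<noteq> s f"
      by (intro AE_PiM_component) (use D e in auto)
  qed
  then show ?thesis using fin by (simp add: AE_finite_all)
qed

theorem theorem1:
  fixes V :: "'v set" and E :: "'v set set" and D :: "'v set \<Rightarrow> real measure"
    and \<sigma> :: "'v set list"
  assumes "graph V E"
    and "\<And>e. e \<in> E \<Longrightarrow> real_distribution (D e)"
    and "\<And>e. e \<in> E \<Longrightarrow> AE x in D e. 0 \<le> x"
    and "distinct \<sigma>" and "set \<sigma> = E"
  shows "((\<forall>e\<in>E. \<forall>x. measure (D e) {x} = 0) \<longrightarrow>
           16 * (\<integral>\<^sup>+ (\<tau>, s, r). ennreal (weight r (alg \<sigma> \<tau> s r)) \<partial>outcomes E D)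
             \<ge> (\<integral>\<^sup>+ (\<tau>, s, r). ennreal (opt E r) \<partial>outcomes E D)) \<and>
         16 * (\<integral>\<^sup>+ (\<tau>, s, r). ennreal (weight r (alg_ties \<sigma> \<tau> s r)) \<partial>outcomes E D)
             \<ge> (\<integral>\<^sup>+ (\<tau>, s, r). ennreal (opt E r) \<partial>outcomes E D)"
proof -
  have fin: "finite E" using assms(5) by auto
  have edges: "card e = 2" if "e \<in> E" for e using assms(1) that by (simp add: graph_def)
  have D: "prob_space (D e)" "sets (D e) = sets borel" if "e \<in> E" for e
    using assms(2)[OF that] real_distribution.events_eq_borel by (auto simp: real_distribution_def)
  have space: "AE x in outcomes E D. fst x \<in> tie_orders E"
    by (rule AE_I2) (auto simp: outcomes_def space_pair_measure space_uniform_count_measure)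
  have ties: "(\<integral>\<^sup>+ (\<tau>, s, r). ennreal (opt E r) \<partial>outcomes E D)
    \<le> 16 * (\<integral>\<^sup>+ (\<tau>, s, r). ennreal (weight r (alg_ties \<sigma> \<tau> s r)) \<partial>outcomes E D)"
  proof -
    have "AE x in outcomes E D. \<forall>e\<in>E. 0 \<le> snd (snd x) e"
      using D fin assms(3) by (rule AE_outcomes_nonneg)
    with space have "(\<integral>\<^sup>+ (\<tau>, s, r). ennreal (weight r (alg_ties \<sigma> \<tau> s r)) \<partial>outcomes E D)
       = (\<integral>\<^sup>+ (\<tau>, s, r). ennreal (weight r (merged_alg \<sigma> \<tau> s r)) \<partial>outcomes E D)"
      by (intro nn_integral_cong_AE, eventually_elim)
        (auto simp: alg_ties_eq_merged[OF _ assms(5)])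
    then show ?thesis
      using nn_integral_opt_le_merged_alg[OF fin edges assms(5) D assms(3)] by simp
  qed
  moreover have "(\<integral>\<^sup>+ (\<tau>, s, r). ennreal (weight r (alg \<sigma> \<tau> s r)) \<partial>outcomes E D)
       = (\<integral>\<^sup>+ (\<tau>, s, r). ennreal (weight r (alg_ties \<sigma> \<tau> s r)) \<partial>outcomes E D)"
    if "\<forall>e\<in>E. \<forall>x. measure (D e) {x} = 0"
  proof -
    have "AE x in outcomes E D. \<forall>e\<in>E. \<forall>f\<in>E. snd (snd x) e \<noteq> fst (snd x) f"
      by (rule AE_outcomes_no_tie) (use D fin that in auto)
    with space show ?thesis
      by (intro nn_integral_cong_AE, eventually_elim)
        (auto simp: alg_eq_alg_ties[OF _ assms(5) edges])
  qed
  ultimately show ?thesis by simp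
qed

end
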